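(* Let $\widetilde{H}$ be the affine Hecke algebra of type $G_2$ and assume $q^2\neq1$. Let $\epsilon\in\{1,-1\}$, $t'=t_{1,\epsilon q}$, $t=s_1s_2t'$ (so that $t(X^{\alpha_2})=q^2$), and $w_0=s_1s_2s_1s_2s_1s_2$. Let $\mathbb{C}v_t$ and $\mathbb{C}v_{w_0t}$ be the $1$-dimensional $\widetilde{H}_{\{2\}}$-modules given by $T_2v_t=qv_t$, $X^\lambda v_t=t(X^\lambda)v_t$, and $T_2v_{w_0t}=-q^{-1}v_{w_0t}$, $X^\lambda v_{w_0t}=(w_0t)(X^\lambda)v_{w_0t}$, and let $M=\widetilde{H}\otimes_{\widetilde{H}_{\{2\}}}\mathbb{C}v_t$ and $N=\widetilde{H}\otimes_{\widetilde{H}_{\{2\}}}\mathbb{C}v_{w_0t}$. Assume that $t'(X^{\alpha_2})\neq q^{-2}$. Then $M$ and $N$ are irreducible.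
   Context: The type $G_2$ root system has simple roots $\alpha_1,\alpha_2$ with $\langle\alpha_1,\alpha_2^\vee\rangle=-1$, $\langle\alpha_2,\alpha_1^\vee\rangle=-3$; $s_i\lambda=\lambda-\langle\lambda,\alpha_i^\vee\rangle\alpha_i$, and $W_0=\langle s_1,s_2\rangle$. $P=\mathbb{Z}\alpha_1+\mathbb{Z}\alpha_2$ is the weight lattice; $X=\{X^\lambda\mid\lambda\in P\}$, $X^\lambda X^\mu=X^{\lambda+\mu}$. For $q\in\mathbb{C}^\times$, $\widetilde{H}$ is the $\mathbb{C}$-algebra generated by $T_1,T_2$ and $X^\lambda$ ($\lambda\in P$), with the group algebra $\mathbb{C}[X]$ a subalgebra, subject to $T_i^2=(q-q^{-1})T_i+1$, $T_1T_2T_1T_2T_1T_2=T_2T_1T_2T_1T_2T_1$, and $X^\lambda T_i=T_iX^{s_i\lambda}+(q-q^{-1})\frac{X^\lambda-X^{s_i\lambda}}{1-X^{-\alpha_i}}$. $\widetilde{H}_{\{i\}}$ is the subalgebra generated by $T_i$ and $\mathbb{C}[X]$. Weights are elements of $T=\mathrm{Hom}(X,\mathbb{C}^\times)$, with $W_0$-action $(wt)(X^\lambda)=t(X^{w^{-1}\lambda})$; $t_{z,w}\in T$ is given by $t_{z,w}(X^{\alpha_1})=z$, $t_{z,w}(X^{\alpha_2})=w$. *)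

theory Defs
  imports
    Complex_Main
    "HOL-Library.Poly_Mapping"
    "HOL-Library.Product_Plus"
    "HOL-Algebra.Algebra"
begin

section \<open>The root system of type \<open>G\<^sub>2\<close>\<close>

datatype node = N1 | N2

text \<open>An element \<open>(a, b)\<close> of \<open>P\<close> stands for \<open>a \<alpha>\<^sub>1 + b \<alpha>\<^sub>2\<close>.\<close>

type_synonym lattice = "int \<times> int"

fun simple_root :: "node \<Rightarrow> lattice" where
  "simple_root N1 = (1, 0)"
| "simple_root N2 = (0, 1)"

text \<open>\<open>cartan i j\<close> is \<open>\<langle>\<alpha>\<^sub>i, \<alpha>\<^sub>j\<^sup>\<or>\<rangle>\<close>, so \<open>\<alpha>\<^sub>1\<close> is the short simple root.\<close>

fun cartan :: "node \<Rightarrow> node \<Rightarrow> int" where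
  "cartan N1 N1 = 2"
| "cartan N1 N2 = -1"
| "cartan N2 N1 = -3"
| "cartan N2 N2 = 2"

definition pairing :: "lattice \<Rightarrow> node \<Rightarrow> int" where
  "pairing l i = fst l * cartan N1 i + snd l * cartan N2 i"

definition scale :: "int \<Rightarrow> lattice \<Rightarrow> lattice" where
  "scale k l = (k * fst l, k * snd l)"

definition srefl :: "node \<Rightarrow> lattice \<Rightarrow> lattice" where
  "srefl i l = l - scale (pairing l i) (simple_root i)"

definition longest :: "lattice \<Rightarrow> lattice" where
  "longest = srefl N1 \<circ> srefl N2 \<circ> srefl N1 \<circ> srefl N2 \<circ> srefl N1 \<circ> srefl N2"

lemma srefl_srefl [simp]: "srefl i (srefl i l) = l"
  by (cases i) (auto simp: srefl_def scale_def pairing_def prod_eq_iff algebra_simps)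

lemma bij_srefl: "bij (srefl i)"
  by (rule o_bij[of "srefl i"]) auto


section \<open>Weights\<close>

text \<open>
  \<open>X\<^sup>\<lambda>\<close> is identified with \<open>\<lambda>\<close>, so that an element of \<open>T = Hom(X, \<complex>\<^sup>\<times>)\<close> becomes a
  function on \<open>P\<close>.
\<close>

definition weights :: "(lattice \<Rightarrow> complex) set" where
  "weights = {t. (\<forall>l. t l \<noteq> 0) \<and> (\<forall>l m. t (l + m) = t l * t m)}"

definition weight_of :: "complex \<Rightarrow> complex \<Rightarrow> lattice \<Rightarrow> complex" where
  "weight_of z w l = z powi fst l * w powi snd l"

text \<open>Meant for \<open>w\<close> in the Weyl group, a group of permutations of \<open>P\<close>.\<close>

definition weyl_act :: "(lattice \<Rightarrow> lattice) \<Rightarrow> (lattice \<Rightarrow> complex) \<Rightarrow> lattice \<Rightarrow> complex" where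
  "weyl_act w t = (\<lambda>l. t (inv_into UNIV w l))"

lemma weight_of_weights: "z \<noteq> 0 \<Longrightarrow> w \<noteq> 0 \<Longrightarrow> weight_of z w \<in> weights"
  by (auto simp: weights_def weight_of_def power_int_add)

lemma weight_of_simple_root [simp]:
  "weight_of z w (simple_root N1) = z" "weight_of z w (simple_root N2) = w"
  by (auto simp: weight_of_def)

lemma weyl_act_srefl [simp]: "weyl_act (srefl i) t l = t (srefl i l)"
  by (simp add: weyl_act_def Hilbert_Choice.inv_f_eq[OF bij_is_inj[OF bij_srefl] srefl_srefl])

lemma weyl_act_comp:
  assumes "bij u" "bij w"
  shows "weyl_act (u \<circ> w) t = weyl_act u (weyl_act w t)"
  using assms by (simp add: weyl_act_def o_inv_distrib fun_eq_iff)

lemma weyl_act_weight_of: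
  assumes "\<epsilon> \<in> {1, -1 :: complex}"
  shows "weyl_act (srefl N1 \<circ> srefl N2) (weight_of 1 (\<epsilon> * q)) (simple_root N2) = q\<^sup>2"
  using assms
  by (auto simp: weyl_act_comp[OF bij_srefl bij_srefl] srefl_def scale_def pairing_def
      weight_of_def power_mult_distrib)


section \<open>The group algebra of the lattice\<close>

text \<open>The product of \<open>\<Rightarrow>\<^sub>0\<close> is convolution, so \<open>lattice \<Rightarrow>\<^sub>0 complex\<close> is \<open>\<complex>[X]\<close>.\<close>

type_synonym group_alg = "lattice \<Rightarrow>\<^sub>0 complex"

abbreviation xmon :: "lattice \<Rightarrow> group_alg" where
  "xmon l \<equiv> Poly_Mapping.single l 1"

text \<open>\<open>is_quot i l f\<close> says that \<open>f = (X\<^sup>\<lambda> - X\<^bsup>s\<^sub>i\<lambda>\<^esup>) / (1 - X\<^bsup>-\<alpha>\<^sub>i\<^esup>)\<close> in \<open>\<complex>[X]\<close>.\<close>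

definition is_quot :: "node \<Rightarrow> lattice \<Rightarrow> group_alg \<Rightarrow> bool" where
  "is_quot i l f \<longleftrightarrow> f * (1 - xmon (- simple_root i)) = xmon l - xmon (srefl i l)"

lemma quot_exists_aux:
  "\<exists>f. f * (1 - xmon (- a)) = xmon l - xmon (l - scale k a)"
proof (induction k rule: int_induct[of _ 0])
  case base
  show ?case by (rule exI[of _ 0]) (simp add: scale_def zero_prod_def[symmetric])
next
  case (step1 k)
  then obtain f where f: "f * (1 - xmon (- a)) = xmon l - xmon (l - scale k a)" by blast
  have *: "l - scale k a - a = l - scale (k + 1) a"
    by (auto simp: scale_def prod_eq_iff algebra_simps)
  have "(f + xmon (l - scale k a)) * (1 - xmon (- a)) = xmon l - xmon (l - scale (k + 1) a)"
    unfolding distrib_right f by (simp add: right_diff_distrib mult_single * del: diff_eq_eq)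
  then show ?case by blast
next
  case (step2 k)
  then obtain f where f: "f * (1 - xmon (- a)) = xmon l - xmon (l - scale k a)" by blast
  have *: "l - scale (k - 1) a - a = l - scale k a"
    by (auto simp: scale_def prod_eq_iff algebra_simps)
  have "(f - xmon (l - scale (k - 1) a)) * (1 - xmon (- a)) =
      xmon l - xmon (l - scale (k - 1) a)"
    unfolding left_diff_distrib[of f] f by (simp add: right_diff_distrib mult_single *)
  then show ?case by blast
qed

lemma no_torsion:
  assumes "f * (1 - xmon (- simple_root i)) = 0"
  shows "f = 0"
proof (rule ccontr)
  assume "f \<noteq> 0"
  define g :: "lattice \<Rightarrow> int" where "g = (\<lambda>l. case i of N1 \<Rightarrow> fst l | N2 \<Rightarrow> snd l)"
  define K where "K = Poly_Mapping.keys f"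
  have K: "finite K" "K \<noteq> {}" using \<open>f \<noteq> 0\<close> by (auto simp: K_def)
  have eq: "f = f * xmon (- simple_root i)" using assms by (simp add: right_diff_distrib)
  have sub: "\<exists>a\<in>K. k = a - simple_root i" if "k \<in> K" for k
  proof -
    have "k \<in> Poly_Mapping.keys (f * xmon (- simple_root i))"
      using that eq by (simp add: K_def)
    then obtain a b where "k = a + b" "a \<in> K" "b \<in> Poly_Mapping.keys (xmon (- simple_root i))"
      using keys_mult[of f "xmon (- simple_root i)"] unfolding K_def by blast
    then have "a \<in> K" "k = a - simple_root i" by (simp_all only: keys_single) simp_all
    then show ?thesis by blast
  qed
  have "Max (g ` K) \<in> g ` K" using K by (intro Max_in) auto
  then obtain m where m: "m \<in> K" "Max (g ` K) = g m" by blast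
  then have max: "g l \<le> g m" if "l \<in> K" for l
    using that K Max_ge[of "g ` K" "g l"] by simp
  from sub[OF m(1)] obtain l where "l \<in> K" "m = l - simple_root i" by blast
  then have "g l = g m + 1" by (cases i) (auto simp: g_def)
  with max[OF \<open>l \<in> K\<close>] show False by simp
qed

lemma quot_unique_exists: "\<exists>!f. is_quot i l f"
proof (rule ex_ex1I)
  show "\<exists>f. is_quot i l f"
    unfolding is_quot_def srefl_def by (rule quot_exists_aux)
next
  fix f g assume "is_quot i l f" "is_quot i l g"
  then have "(f - g) * (1 - xmon (- simple_root i)) = 0"
    by (simp add: is_quot_def left_diff_distrib)
  then have "f - g = 0" by (rule no_torsion)
  then show "f = g" by simp
qed


section \<open>The free algebra on \<open>T\<^sub>1\<close>, \<open>T\<^sub>2\<close> and the \<open>X\<^sup>\<lambda>\<close>\<close>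

datatype gen = GenT node | GenX lattice

text \<open>The free monoid, written additively because that is what \<open>\<Rightarrow>\<^sub>0\<close> requires of its keys.\<close>

datatype word = Word "gen list"

instantiation word :: monoid_add
begin

definition zero_word :: word where "0 = Word []"

fun plus_word :: "word \<Rightarrow> word \<Rightarrow> word" where
  "Word u + Word v = Word (u @ v)"

instance
proof
  fix a b c :: word
  show "a + b + c = a + (b + c)" by (cases a; cases b; cases c) simp
  show "0 + a = a" by (cases a) (simp add: zero_word_def)
  show "a + 0 = a" by (cases a) (simp add: zero_word_def)
qed

end

type_synonym free_alg = "word \<Rightarrow>\<^sub>0 complex"

definition free_ring :: "free_alg ring" where
  "free_ring = \<lparr>carrier = UNIV, monoid.mult = (*), one = 1, ring.zero = 0, ring.add = (+)\<rparr>"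

definition fscal :: "complex \<Rightarrow> free_alg" where
  "fscal z = Poly_Mapping.single 0 z"

definition fgen :: "gen \<Rightarrow> free_alg" where
  "fgen g = Poly_Mapping.single (Word [g]) 1"

definition fpoly :: "group_alg \<Rightarrow> free_alg" where
  "fpoly f = (\<Sum>l\<in>Poly_Mapping.keys f. fscal (Poly_Mapping.lookup f l) * fgen (GenX l))"

lemma ring_free_ring: "ring free_ring"
proof (rule ringI)
  show "abelian_group free_ring"
    by (rule abelian_groupI) (auto simp: free_ring_def add.assoc add.commute intro: exI[of _ "- _"])
  show "monoid free_ring"
    by (rule monoidI) (auto simp: free_ring_def mult.assoc)
qed (auto simp: free_ring_def distrib_left distrib_right)


section \<open>The affine Hecke algebra\<close>

definition hecke_rels :: "complex \<Rightarrow> free_alg set" where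
  "hecke_rels q =
     {fgen (GenT i) ^ 2 - (fscal (q - inverse q) * fgen (GenT i) + 1) | i. True}
   \<union> {(fgen (GenT N1) * fgen (GenT N2)) ^ 3 - (fgen (GenT N2) * fgen (GenT N1)) ^ 3}
   \<union> {fgen (GenX 0) - 1}
   \<union> {fgen (GenX l) * fgen (GenX m) - fgen (GenX (l + m)) | l m. True}
   \<union> {fgen (GenX l) * fgen (GenT i)
        - (fgen (GenT i) * fgen (GenX (srefl i l)) + fscal (q - inverse q) * fpoly f) | l i f. is_quot i l f}"

text \<open>\<open>Idl\<close> is the generated two-sided ideal, as \<open>ideal\<close> is two-sided.\<close>

definition hecke_ideal :: "complex \<Rightarrow> free_alg set" where
  "hecke_ideal q = Idl\<^bsub>free_ring\<^esub> (hecke_rels q)"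

definition hecke :: "complex \<Rightarrow> free_alg set ring" where
  "hecke q = free_ring Quot (hecke_ideal q)"

definition hcls :: "complex \<Rightarrow> free_alg \<Rightarrow> free_alg set" where
  "hcls q x = hecke_ideal q +>\<^bsub>free_ring\<^esub> x"

lemma ring_hecke: "ring (hecke q)"
proof -
  interpret ring free_ring by (rule ring_free_ring)
  have "ideal (hecke_ideal q) free_ring"
    unfolding hecke_ideal_def by (rule genideal_ideal) (simp add: free_ring_def)
  then show ?thesis unfolding hecke_def by (rule ideal.quotient_is_ring)
qed

text \<open>
  The generators include all of \<open>\<complex>[X]\<close> and hence the scalars, so the generated subring is
  the generated subalgebra.
\<close>

definition hecke_sub :: "complex \<Rightarrow> node \<Rightarrow> free_alg set set" where
  "hecke_sub q i = generate_ring (hecke q) (insert (hcls q (fgen (GenT i))) (range (hcls q \<circ> fpoly)))"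

lemma ring_hecke_sub: "ring ((hecke q)\<lparr>carrier := hecke_sub q i\<rparr>)"
  unfolding hecke_sub_def
  by (rule ring.generate_ring_is_ring[OF ring_hecke])
     (auto simp: hecke_def hcls_def FactRing_def A_RCOSETS_def RCOSETS_def a_r_coset_def free_ring_def)


section \<open>Modules over noncommutative rings\<close>

text \<open>The library's \<open>module\<close> demands a commutative ring.\<close>

locale left_module = R?: ring R + M?: abelian_group M
  for R :: "('a, 'c) ring_scheme" (structure) and M :: "('a, 'b, 'm) module_scheme" (structure) +
  assumes lsmult_closed: "\<lbrakk>a \<in> carrier R; x \<in> carrier M\<rbrakk> \<Longrightarrow> a \<odot>\<^bsub>M\<^esub> x \<in> carrier M"
    and lsmult_l_distr: "\<lbrakk>a \<in> carrier R; b \<in> carrier R; x \<in> carrier M\<rbrakk> \<Longrightarrow>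
      (a \<oplus>\<^bsub>R\<^esub> b) \<odot>\<^bsub>M\<^esub> x = a \<odot>\<^bsub>M\<^esub> x \<oplus>\<^bsub>M\<^esub> b \<odot>\<^bsub>M\<^esub> x"
    and lsmult_r_distr: "\<lbrakk>a \<in> carrier R; x \<in> carrier M; y \<in> carrier M\<rbrakk> \<Longrightarrow>
      a \<odot>\<^bsub>M\<^esub> (x \<oplus>\<^bsub>M\<^esub> y) = a \<odot>\<^bsub>M\<^esub> x \<oplus>\<^bsub>M\<^esub> a \<odot>\<^bsub>M\<^esub> y"
    and lsmult_assoc: "\<lbrakk>a \<in> carrier R; b \<in> carrier R; x \<in> carrier M\<rbrakk> \<Longrightarrow>
      (a \<otimes>\<^bsub>R\<^esub> b) \<odot>\<^bsub>M\<^esub> x = a \<odot>\<^bsub>M\<^esub> (b \<odot>\<^bsub>M\<^esub> x)"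
    and lsmult_one: "x \<in> carrier M \<Longrightarrow> \<one>\<^bsub>R\<^esub> \<odot>\<^bsub>M\<^esub> x = x"

text \<open>The locale \<open>submodule\<close> itself does not presuppose commutativity.\<close>

definition irreducible_module :: "('a, 'c) ring_scheme \<Rightarrow> ('a, 'b, 'm) module_scheme \<Rightarrow> bool" where
  "irreducible_module R M \<longleftrightarrow>
     left_module R M \<and> carrier M \<noteq> {\<zero>\<^bsub>M\<^esub>} \<and>
     (\<forall>K. submodule K R M \<longrightarrow> K = {\<zero>\<^bsub>M\<^esub>} \<or> K = carrier M)"


section \<open>Induced modules\<close>

text \<open>
  For a subring \<open>S\<close> of \<open>R\<close> and a left \<open>S\<close>-module \<open>V\<close>, the tensor product of \<open>R\<close> and \<open>V\<close>
  over \<open>S\<close> is the free abelian group on \<open>R \<times> V\<close> modulo the subgroup generated by the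
  biadditivity and balancing relations; \<open>r\<close> acts by \<open>r (a \<otimes> v) = (r a) \<otimes> v\<close>.
\<close>

definition tensor_rels ::
  "('a, 'c) ring_scheme \<Rightarrow> 'a set \<Rightarrow> ('a, 'v, 'm) module_scheme \<Rightarrow> ('a \<times> 'v \<Rightarrow>\<^sub>0 int) set" where
  "tensor_rels R S V =
     {frag_of (a \<oplus>\<^bsub>R\<^esub> b, v) - frag_of (a, v) - frag_of (b, v)
        | a b v. a \<in> carrier R \<and> b \<in> carrier R \<and> v \<in> carrier V}
   \<union> {frag_of (a, v \<oplus>\<^bsub>V\<^esub> w) - frag_of (a, v) - frag_of (a, w)
        | a v w. a \<in> carrier R \<and> v \<in> carrier V \<and> w \<in> carrier V}
   \<union> {frag_of (a \<otimes>\<^bsub>R\<^esub> s, v) - frag_of (a, s \<odot>\<^bsub>V\<^esub> v)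
        | a s v. a \<in> carrier R \<and> s \<in> S \<and> v \<in> carrier V}"

text \<open>The two ring fields of the record \<open>module\<close> that play no role are left unspecified.\<close>

definition induced_module ::
  "('a, 'c) ring_scheme \<Rightarrow> 'a set \<Rightarrow> ('a, 'v, 'm) module_scheme
     \<Rightarrow> ('a, ('a \<times> 'v \<Rightarrow>\<^sub>0 int) set) module" where
  "induced_module R S V =
     (let F = free_Abelian_group (carrier R \<times> carrier V);
          N = generate F (tensor_rels R S V)
      in \<lparr>carrier = carrier (F Mod N), monoid.mult = undefined, one = undefined,
          ring.zero = \<one>\<^bsub>F Mod N\<^esub>, ring.add = (\<otimes>\<^bsub>F Mod N\<^esub>),
          smult = (\<lambda>r C. \<Union>x\<in>C. N #>\<^bsub>F\<^esub> frag_extend (\<lambda>(a, v). frag_of (r \<otimes>\<^bsub>R\<^esub> a, v)) x)\<rparr>)"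


section \<open>One-dimensional modules of the parabolic subalgebras\<close>

text \<open>
  \<open>V = \<complex>v\<close> is a one-dimensional module over the subalgebra generated by \<open>T\<^sub>i\<close> and \<open>\<complex>[X]\<close>,
  with \<open>T\<^sub>i v = c v\<close> and \<open>X\<^sup>\<lambda> v = t(X\<^sup>\<lambda>) v\<close>.
\<close>

definition line_module ::
  "complex \<Rightarrow> node \<Rightarrow> complex \<Rightarrow> (lattice \<Rightarrow> complex) \<Rightarrow> (free_alg set, 'v) module \<Rightarrow> 'v \<Rightarrow> bool" where
  "line_module q i c t V v \<longleftrightarrow>
     left_module ((hecke q)\<lparr>carrier := hecke_sub q i\<rparr>) V \<and>
     v \<in> carrier V \<and> v \<noteq> \<zero>\<^bsub>V\<^esub> \<and>
     carrier V = {hcls q (fscal z) \<odot>\<^bsub>V\<^esub> v | z. True} \<and>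
     hcls q (fgen (GenT i)) \<odot>\<^bsub>V\<^esub> v = hcls q (fscal c) \<odot>\<^bsub>V\<^esub> v \<and>
     (\<forall>l. hcls q (fgen (GenX l)) \<odot>\<^bsub>V\<^esub> v = hcls q (fscal (t l)) \<odot>\<^bsub>V\<^esub> v)"

end

theory Submission
  imports Defs
begin

text \<open>
  \<^bold>\<open>Reduction to one module.\<close> The algebra depends on \<open>q\<close> only through \<open>q - q\<^sup>-\<^sup>1\<close>, so \<open>q\<close> may be
  replaced by \<open>- q\<^sup>-\<^sup>1\<close>. Since \<open>w\<^sub>0 = -1\<close>, this turns \<open>N\<close> into the module \<open>M\<close> for the new parameter
  and the sign \<open>-\<epsilon>\<close>, and the hypotheses are symmetric. So only \<open>M\<close> is treated.

  \<^bold>\<open>Why \<open>M\<close> is irreducible.\<close> Put \<open>e = \<epsilon> q\<close>. The module \<open>M\<close> has dimension six, and its generalised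
  weight spaces, for the weights \<open>t'\<close>, \<open>s\<^sub>2 t'\<close> and \<open>t = s\<^sub>1 s\<^sub>2 t'\<close>, have dimension two each. Passing from
  \<open>t'\<close> to \<open>s\<^sub>2 t'\<close> and on to \<open>t\<close>, the relevant simple root has the value \<open>e\<close>, which differs from
  \<open>q\<^sup>2\<close> and \<open>q\<^sup>-\<^sup>2\<close>; so the intertwiners are bijections between the three spaces, and a nonzero
  submodule meets the \<open>t'\<close>-space. There \<open>X\<^bsup>\<alpha>\<^sub>1\<^esup>\<close> has the only eigenvalue \<open>1\<close> and the space is an
  irreducible module for \<open>T\<^sub>1\<close> and the \<open>X\<^sup>\<lambda>\<close>. Hence the submodule contains it, and everything.

  \<^bold>\<open>How this is carried out.\<close> The weight spaces are made explicit in a six-dimensional model. That it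
  satisfies the relations is a matrix computation (\<open>T_model_quadratic\<close>, \<open>T_model_braid\<close>,
  \<open>X_T_model\<close>), in which the quotients \<open>(X\<^sup>\<lambda> - X\<^bsup>s\<^sub>i\<lambda>\<^esup>) / (1 - X\<^bsup>-\<alpha>\<^sub>i\<^esup>)\<close> are handled for all \<open>\<lambda>\<close> at once
  by \<open>lin_ext_telescope\<close>; the argument above for its irreducibility is \<open>model_irreducible\<close>.
  The map from \<open>M\<close> to the model exists by the universal property of the tensor product
  (\<open>tensor_zeroD\<close>). It is injective, because \<open>M\<close> is spanned by the six vectors
  \<open>T\<^sub>w (1 \<otimes> v)\<close> (\<open>T_coset_spanning\<close>), whose images are independent (\<open>T_coset_independent\<close>). So
  \<open>M\<close> is nonzero, and a submodule of \<open>M\<close> can be tested in the model.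
\<close>

section \<open>A six-dimensional model\<close>

type_synonym vec6 = "complex \<times> complex \<times> complex \<times> complex \<times> complex \<times> complex"

text \<open>
  Coordinates are taken with respect to a basis \<open>m, f, g, g', f', m'\<close>. The pairs \<open>m, m'\<close> and
  \<open>f, f'\<close> and \<open>g, g'\<close> span the generalised weight spaces of \<open>t\<close>, \<open>s\<^sub>2 t'\<close> and \<open>t'\<close>; the
  unprimed vectors are weight vectors.
\<close>

definition csc :: "complex \<Rightarrow> vec6 \<Rightarrow> vec6" where
  "csc z = (\<lambda>(a0, a1, a2, a3, a4, a5). (z * a0, z * a1, z * a2, z * a3, z * a4, z * a5))"

lemma csc_simp [simp]:
  "csc z (a0, a1, a2, a3, a4, a5) = (z * a0, z * a1, z * a2, z * a3, z * a4, z * a5)"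
  by (simp add: csc_def)

interpretation vec6: vector_space csc
  by standard (auto simp: csc_def algebra_simps split: prod.splits)

text \<open>
  With \<open>e = \<epsilon> q\<close>, the Hecke generator \<open>T\<^sub>i\<close> acts on the model as \<open>\<epsilon>\<close> times \<open>T_model e i\<close>: all signs
  \<open>\<epsilon>\<close> can be removed because the relations of the algebra are stable under changing the sign of
  \<open>q\<close>, \<open>T\<^sub>1\<close> and \<open>T\<^sub>2\<close> together, and then only Laurent polynomials in \<open>e\<close> occur.

  Let \<open>T\<^sub>i\<close> now stand for \<open>T_model e i\<close> and \<open>k = e - e\<^sup>-\<^sup>1\<close>. The formulas come from the intertwiners
  \<open>\<tau>\<^sub>i = T\<^sub>i - k / (1 - X\<^bsup>-\<alpha>\<^sub>i\<^esup>)\<close>, which map the generalised \<open>u\<close>-weight space to that of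
  \<open>s\<^sub>i u\<close>. The basis is normalised by
  \<open>f = \<tau>\<^sub>1 m\<close>, \<open>g = \<tau>\<^sub>2 f\<close>, \<open>g' = T\<^sub>1 g\<close>, and \<open>\<tau>\<^sub>2 f' = g'\<close>, \<open>\<tau>\<^sub>1 m' = f'\<close>. If \<open>E\<close> denotes
  the nilpotent map that removes the primes, then \<open>\<tau>\<^sub>1\<^sup>2 = (1 - c) - c\<^sup>2 E\<close> on the \<open>t\<close>-space and
  \<open>\<tau>\<^sub>2\<^sup>2 = (1 - c) - 3 c\<^sup>2 E\<close> on the \<open>s\<^sub>2 t'\<close>-space, where \<open>c = e + 2 + e\<^sup>-\<^sup>1\<close>; so
  the intertwiners are invertible as long as \<open>1 - c = - (e\<^sup>2 + e + 1) / e\<close> does not vanish.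
  On the \<open>t\<close>-space \<open>T\<^sub>2\<close> is a scalar.
\<close>

fun T_model :: "complex \<Rightarrow> node \<Rightarrow> vec6 \<Rightarrow> vec6" where
  "T_model e N1 (a0, a1, a2, a3, a4, a5) = (let p = inverse e; c = e + 2 + p in
     (- (1 + p) * a0 - c * a5 + (1 - c) * a1 - c\<^sup>2 * a4,
      a0 + (e + 1) * a1 + c * a4,
      a3,
      a2 + (e - p) * a3,
      a5 + (e + 1) * a4,
      - (1 + p) * a5 + (1 - c) * a4))"
| "T_model e N2 (a0, a1, a2, a3, a4, a5) = (let p = inverse e; c = e + 2 + p in
     (e * a0,
      - (1 + p) * a1 - 3 * c * a4 + (1 - c) * a2 - 3 * c\<^sup>2 * a3,
      a1 + (e + 1) * a2 + 3 * c * a3,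
      a4 + (e + 1) * a3,
      - (1 + p) * a4 + (1 - c) * a3,
      e * a5))"

text \<open>
  Each \<open>X\<^sup>\<lambda>\<close> acts on a generalised weight space by its weight times a unipotent matrix
  \<open>1 + n(\<lambda>) E\<close> with \<open>n\<close> additive. On the \<open>t'\<close>-space \<open>n(\<lambda>) = k \<langle>\<lambda>, \<alpha>\<^sub>1\<^sup>\<or>\<rangle>\<close>, which is forced by
  \<open>g' = T\<^sub>1 g\<close> and the cross relation; the intertwiners transport it to the other two spaces.
\<close>

fun X_model :: "complex \<Rightarrow> lattice \<Rightarrow> vec6 \<Rightarrow> vec6" where
  "X_model e (x, y) (a0, a1, a2, a3, a4, a5) = (let k = e - inverse e in
     (e powi (2 * y - x) * (a0 + k * of_int x * a5),
      e powi (x - y) * (a1 + k * of_int (3 * y - x) * a4),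
      e powi y * (a2 + k * of_int (2 * x - 3 * y) * a3),
      e powi y * a3,
      e powi (x - y) * a4,
      e powi (2 * y - x) * a5))"

lemma T_model_quadratic:
  assumes "e \<noteq> 0"
  shows "T_model e i (T_model e i u) = csc (e - inverse e) (T_model e i u) + u"
proof -
  obtain a0 a1 a2 a3 a4 a5 where u: "u = (a0, a1, a2, a3, a4, a5)" by (cases u) auto
  obtain p where p: "p = inverse e" "e * p = 1" using assms by simp
  have ep: "e * (p * z) = z" "e * p = 1" for z
    using p(2) by (simp_all add: mult.assoc[symmetric])
  have "T_model e N1 (T_model e N1 u) = csc (e - inverse e) (T_model e N1 u) + u"
    unfolding u by (simp add: Let_def p(1)[symmetric]; simp add: algebra_simps power2_eq_square ep)
  moreover have "T_model e N2 (T_model e N2 u) = csc (e - inverse e) (T_model e N2 u) + u"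
    unfolding u by (simp add: Let_def p(1)[symmetric]; simp add: algebra_simps power2_eq_square ep)
  ultimately show ?thesis by (cases i) simp_all
qed

lemma T_model_linear: "T_model e i (u + v) = T_model e i u + T_model e i v"
   "T_model e i (csc z u) = csc z (T_model e i u)"
proof -
  obtain a0 a1 a2 a3 a4 a5 where u: "u = (a0, a1, a2, a3, a4, a5)" by (cases u) auto
  obtain b0 b1 b2 b3 b4 b5 where v: "v = (b0, b1, b2, b3, b4, b5)" by (cases v) auto
  show "T_model e i (u + v) = T_model e i u + T_model e i v"
    unfolding u v by (cases i) (simp_all add: Let_def ring_distribs)
  show "T_model e i (csc z u) = csc z (T_model e i u)"
    unfolding u v by (cases i) (simp_all add: Let_def ring_distribs mult_ac)
qed

lemma vec6_expand:
  "(a0, a1, a2, a3, a4, a5) = csc a0 (1, 0, 0, 0, 0, 0) + csc a1 (0, 1, 0, 0, 0, 0)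
    + csc a2 (0, 0, 1, 0, 0, 0) + csc a3 (0, 0, 0, 1, 0, 0) + csc a4 (0, 0, 0, 0, 1, 0)
    + csc a5 (0, 0, 0, 0, 0, 1)"
  by simp

text \<open>
  Both sides are linear, so the relation is checked on the standard basis, where all entries
  are Laurent polynomials in \<open>e\<close>.
\<close>

lemma T_model_braid:
  assumes "e \<noteq> 0"
  defines "T \<equiv> T_model e N1" and "S \<equiv> T_model e N2"
  shows "T (S (T (S (T (S u))))) = S (T (S (T (S (T u)))))"
proof -
  obtain a0 a1 a2 a3 a4 a5 where u: "u = (a0, a1, a2, a3, a4, a5)" by (cases u) auto
  obtain p where p: "p = inverse e" "e * p = 1" using assms by simp
  have ep: "e * (p * z) = z" "e * p = 1" for z
    using p(2) by (simp_all add: mult.assoc[symmetric])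
  note rules = T_def S_def Let_def p(1)[symmetric] algebra_simps power2_eq_square ep
  have "\<forall>b \<in> {(1, 0, 0, 0, 0, 0), (0, 1, 0, 0, 0, 0), (0, 0, 1, 0, 0, 0), (0, 0, 0, 1, 0, 0),
      (0, 0, 0, 0, 1, 0), (0, 0, 0, 0, 0, 1)}.
      T (S (T (S (T (S b))))) = S (T (S (T (S (T b)))))"
    by (intro ballI; elim insertE emptyE; hypsubst; simp add: rules)
  then show ?thesis unfolding u vec6_expand[of a0] T_def S_def
    by (simp only: T_model_linear ball_simps)
qed

lemma X_model_0: "X_model e 0 u = u"
  by (cases u) (auto simp: zero_prod_def)

lemma X_model_linear: "X_model e l (u + v) = X_model e l u + X_model e l v"
   "X_model e l (csc z u) = csc z (X_model e l u)"
proof -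
  obtain a0 a1 a2 a3 a4 a5 where u: "u = (a0, a1, a2, a3, a4, a5)" by (cases u) auto
  obtain b0 b1 b2 b3 b4 b5 where v: "v = (b0, b1, b2, b3, b4, b5)" by (cases v) auto
  obtain x y where l: "l = (x, y)" by (cases l)
  show "X_model e l (u + v) = X_model e l u + X_model e l v"
    unfolding u v l by (simp add: Let_def ring_distribs)
  show "X_model e l (csc z u) = csc z (X_model e l u)"
    unfolding u v l by (simp add: Let_def ring_distribs mult_ac)
qed

lemma X_model_add:
  assumes "e \<noteq> 0"
  shows "X_model e l (X_model e m u) = X_model e (l + m) u"
proof -
  obtain a0 a1 a2 a3 a4 a5 where u: "u = (a0, a1, a2, a3, a4, a5)" by (cases u) auto
  obtain x y x' y' where l: "l = (x, y)" "m = (x', y')" by (cases l, cases m) auto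
  have pw: "e powi (2 * (y + y') - (x + x')) = e powi (2 * y - x) * e powi (2 * y' - x')"
    "e powi (x + x' - (y + y')) = e powi (x - y) * e powi (x' - y')"
    "e powi (y + y') = e powi y * e powi y'"
    using assms by (simp_all add: power_int_add[symmetric] algebra_simps)
  show ?thesis unfolding u l
    by (simp only: X_model.simps Let_def plus_prod_def fst_conv snd_conv pw)
      (simp add: algebra_simps)
qed

section \<open>Linear functionals on the group algebra and the cross relation\<close>

definition lin_ext :: "('a \<Rightarrow> complex) \<Rightarrow> ('a \<Rightarrow>\<^sub>0 complex) \<Rightarrow> complex" where
  "lin_ext \<phi> f = (\<Sum>l\<in>Poly_Mapping.keys f. Poly_Mapping.lookup f l * \<phi> l)"

lemma lin_ext_superset:
  "finite A \<Longrightarrow> Poly_Mapping.keys f \<subseteq> A \<Longrightarrow> lin_ext \<phi> f = (\<Sum>l\<in>A. Poly_Mapping.lookup f l * \<phi> l)"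
  unfolding lin_ext_def by (rule sum.mono_neutral_left) (auto simp: in_keys_iff)

lemma lin_ext_add: "lin_ext \<phi> (f + g) = lin_ext \<phi> f + lin_ext \<phi> g"
proof -
  let ?A = "Poly_Mapping.keys f \<union> Poly_Mapping.keys g"
  have "Poly_Mapping.keys (f + g) \<subseteq> ?A" by (rule Poly_Mapping.keys_add)
  then show ?thesis
    by (simp add: lin_ext_superset[of ?A] lookup_add distrib_right sum.distrib)
qed

lemma lin_ext_single [simp]: "lin_ext \<phi> (Poly_Mapping.single l z) = z * \<phi> l"
  by (simp add: lin_ext_def)

lemma poly_mapping_induct_single [case_names zero single add]:
  fixes f :: "'a \<Rightarrow>\<^sub>0 'b::comm_monoid_add"
  assumes "P 0" "\<And>l z. P (Poly_Mapping.single l z)" "\<And>f g. P f \<Longrightarrow> P g \<Longrightarrow> P (f + g)"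
  shows "P f"
proof -
  have "f = (\<Sum>k\<in>Poly_Mapping.keys f. Poly_Mapping.single k (Poly_Mapping.lookup f k))"
    by (rule poly_mapping_eqI) (simp add: lookup_sum lookup_single when_def in_keys_iff)
  moreover have "P (\<Sum>k\<in>A. Poly_Mapping.single k (Poly_Mapping.lookup f k))" for A
    by (induction A rule: infinite_finite_induct) (auto intro: assms)
  ultimately show ?thesis by metis
qed

lemma lin_ext_minus: "lin_ext \<phi> (- f) = - lin_ext \<phi> f"
  by (simp add: lin_ext_def sum_negf)

lemma lin_ext_diff: "lin_ext \<phi> (f - g) = lin_ext \<phi> f - lin_ext \<phi> g"
  using lin_ext_add[of \<phi> f "- g"] by (simp add: lin_ext_minus)

lemma lin_ext_shift: "lin_ext \<phi> (f * xmon m) = lin_ext (\<lambda>l. \<phi> (l + m)) f"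
  by (induction f rule: poly_mapping_induct_single)
    (simp_all add: lin_ext_add distrib_right mult_single lin_ext_def[of _ 0])

text \<open>
  The element \<open>f = (X\<^sup>\<lambda> - X\<^bsup>s\<^sub>i\<lambda>\<^esup>) / (1 - X\<^bsup>-\<alpha>\<^sub>i\<^esup>)\<close> of the group algebra need not be computed to be
  evaluated. Applying the functional \<open>\<phi>\<close> to \<open>f (1 - X\<^bsup>-\<alpha>\<^sub>i\<^esup>)\<close> applies its difference in
  direction \<open>\<alpha>\<^sub>i\<close> to \<open>f\<close>; hence \<open>\<psi>\<close> is evaluated on \<open>f\<close> by finding a discrete antiderivative of it.
\<close>

lemma lin_ext_telescope:
  assumes f: "is_quot i l f" and \<phi>: "\<And>m. \<phi> m - \<phi> (m - simple_root i) = \<psi> m"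
  shows "lin_ext \<psi> f = \<phi> l - \<phi> (srefl i l)"
proof -
  have "lin_ext \<phi> (f * (1 - xmon (- simple_root i))) = lin_ext \<phi> (xmon l - xmon (srefl i l))"
    using f by (simp add: is_quot_def)
  then have "lin_ext \<phi> f - lin_ext (\<lambda>m. \<phi> (m - simple_root i)) f = \<phi> l - \<phi> (srefl i l)"
    by (simp add: lin_ext_diff lin_ext_shift right_diff_distrib)
  moreover have "lin_ext \<phi> f - lin_ext (\<lambda>m. \<phi> (m - simple_root i)) f = lin_ext \<psi> f"
    by (simp add: lin_ext_def sum_subtractf[symmetric] right_diff_distrib[symmetric] \<phi>)
  ultimately show ?thesis by simp
qed

text \<open>
  A matrix entry of the action of \<open>f\<close> on the model is the value at \<open>f\<close> of the functional that
  extends the corresponding matrix entry of \<open>X\<^sup>\<lambda>\<close>.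
\<close>

lemma sum_X_model:
  fixes e :: complex
  defines "k \<equiv> e - inverse e"
  defines "\<sigma> \<equiv> \<lambda>(x, y). e powi (2 * y - x)" and "\<tau> \<equiv> \<lambda>(x, y). e powi (x - y)"
    and "\<rho> \<equiv> \<lambda>(x, y). e powi y"
  shows "(\<Sum>l\<in>Poly_Mapping.keys f. csc (Poly_Mapping.lookup f l) (X_model e l (a0, a1, a2, a3, a4, a5))) =
    (lin_ext \<sigma> f * a0 + k * lin_ext (\<lambda>(x, y). \<sigma> (x, y) * of_int x) f * a5,
     lin_ext \<tau> f * a1 + k * lin_ext (\<lambda>(x, y). \<tau> (x, y) * of_int (3 * y - x)) f * a4,
     lin_ext \<rho> f * a2 + k * lin_ext (\<lambda>(x, y). \<rho> (x, y) * of_int (2 * x - 3 * y)) f * a3,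
     lin_ext \<rho> f * a3, lin_ext \<tau> f * a4, lin_ext \<sigma> f * a5)"
proof -
  have "(\<Sum>l\<in>A. csc (g l) (X_model e l (a0, a1, a2, a3, a4, a5))) =
    ((\<Sum>l\<in>A. g l * \<sigma> l) * a0 + k * (\<Sum>l\<in>A. g l * (\<sigma> l * of_int (fst l))) * a5,
     (\<Sum>l\<in>A. g l * \<tau> l) * a1 + k * (\<Sum>l\<in>A. g l * (\<tau> l * of_int (3 * snd l - fst l))) * a4,
     (\<Sum>l\<in>A. g l * \<rho> l) * a2 + k * (\<Sum>l\<in>A. g l * (\<rho> l * of_int (2 * fst l - 3 * snd l))) * a3,
     (\<Sum>l\<in>A. g l * \<rho> l) * a3, (\<Sum>l\<in>A. g l * \<tau> l) * a4, (\<Sum>l\<in>A. g l * \<sigma> l) * a5)"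
    for A and g :: "lattice \<Rightarrow> complex"
    by (induction A rule: infinite_finite_induct)
      (auto simp: zero_prod_def k_def \<sigma>_def \<tau>_def \<rho>_def algebra_simps Let_def)
  then show ?thesis by (simp add: lin_ext_def case_prod_unfold)
qed

text \<open>
  A weight with \<open>X\<^bsup>-\<alpha>\<^sub>i\<^esup> \<mapsto> d \<noteq> 1\<close> is, up to the factor \<open>1 - d\<close>, its own antiderivative; for the
  product of the weight with an additive function the correction term is a multiple of the weight.
\<close>

lemma lin_ext_quot_weight:
  assumes f: "is_quot i l f" and w: "\<And>m. w (m - simple_root i) = d * w m" and "d \<noteq> 1"
  shows "(1 - d) * lin_ext w f = w l - w (srefl i l)"
proof -
  define A where "A = inverse (1 - d)"
  have A: "A * (1 - d) = 1" using \<open>d \<noteq> 1\<close> by (simp add: A_def)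
  have "lin_ext w f = A * w l - A * w (srefl i l)"
  proof (rule lin_ext_telescope[OF f])
    fix m
    have "A * w m - A * w (m - simple_root i) = A * (1 - d) * w m"
      unfolding w by (simp add: algebra_simps)
    then show "A * w m - A * w (m - simple_root i) = w m" by (simp add: A)
  qed
  then have "(1 - d) * lin_ext w f = A * (1 - d) * (w l - w (srefl i l))"
    by (simp only:) (simp add: algebra_simps)
  then show ?thesis by (simp add: A)
qed

lemma lin_ext_quot_weight_linear:
  assumes f: "is_quot i l f" and w: "\<And>m. w (m - simple_root i) = d * w m" and "d \<noteq> 1"
    and n: "\<And>m. n (m - simple_root i) = n m - \<nu>"
  shows "(1 - d)\<^sup>2 * lin_ext (\<lambda>m. w m * n m) f =
    (1 - d) * (w l * n l - w (srefl i l) * n (srefl i l)) - \<nu> * d * (w l - w (srefl i l))"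
proof -
  define A where "A = inverse (1 - d)"
  have A: "A * (1 - d) = 1" using \<open>d \<noteq> 1\<close> by (simp add: A_def)
  let ?\<phi> = "\<lambda>m. w m * (A * n m - A\<^sup>2 * \<nu> * d)"
  have "lin_ext (\<lambda>m. w m * n m) f = ?\<phi> l - ?\<phi> (srefl i l)"
  proof (rule lin_ext_telescope[OF f])
    fix m
    have "?\<phi> m - ?\<phi> (m - simple_root i) =
        w m * (A * (1 - d) * n m + \<nu> * d * A * (1 - A * (1 - d)))"
      unfolding w n by (simp add: algebra_simps power2_eq_square)
    then show "?\<phi> m - ?\<phi> (m - simple_root i) = w m * n m" by (simp add: A)
  qed
  then have "(1 - d)\<^sup>2 * lin_ext (\<lambda>m. w m * n m) f =
      (1 - d) * (A * (1 - d)) * (w l * n l - w (srefl i l) * n (srefl i l))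
      - (A * (1 - d))\<^sup>2 * (\<nu> * d * (w l - w (srefl i l)))"
    by (simp only:) (simp add: algebra_simps power2_eq_square)
  then show ?thesis by (simp add: A)
qed

text \<open>
  After the functionals on the quotient are evaluated, both sides are polynomials in
  \<open>e\<close>, \<open>e\<^sup>-\<^sup>1\<close>, the two coordinates of \<open>\<lambda>\<close> and the values of the weights at \<open>\<lambda>\<close>. The letters
  \<open>\<sigma>\<close>, \<open>\<tau>\<close>, \<open>\<rho>\<close> stand for the weights \<open>t\<close>, \<open>s\<^sub>2 t'\<close>, \<open>t'\<close>, and \<open>n2\<close>, \<open>n1\<close>, \<open>n0\<close> for the
  corresponding additive functions without their common factor \<open>k\<close>.
\<close>

lemma X_T_model:
  assumes f: "is_quot i l f" and e: "e \<noteq> 0" "e\<^sup>2 \<noteq> 1"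
  shows "X_model e l (T_model e i u) = T_model e i (X_model e (srefl i l) u) +
    csc (e - inverse e) (\<Sum>m\<in>Poly_Mapping.keys f. csc (Poly_Mapping.lookup f m) (X_model e m u))"
proof -
  obtain a0 a1 a2 a3 a4 a5 where u: "u = (a0, a1, a2, a3, a4, a5)" by (cases u) auto
  obtain x y where l: "l = (x, y)" by (cases l)
  define p where "p = inverse e"
  define k where "k = e - p"
  define c where "c = e + 2 + p"
  have p: "e * p = 1" and e1: "e \<noteq> 1" "p \<noteq> 1" "p\<^sup>2 \<noteq> 1"
    using e by (auto simp: p_def power_inverse)
  define \<sigma> :: "lattice \<Rightarrow> complex" where "\<sigma> = (\<lambda>(x, y). e powi (2 * y - x))"
  define \<tau> :: "lattice \<Rightarrow> complex" where "\<tau> = (\<lambda>(x, y). e powi (x - y))"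
  define \<rho> :: "lattice \<Rightarrow> complex" where "\<rho> = (\<lambda>(x, y). e powi y)"
  define n0 :: "lattice \<Rightarrow> complex" where "n0 = (\<lambda>(x, y). of_int (2 * x - 3 * y))"
  define n1 :: "lattice \<Rightarrow> complex" where "n1 = (\<lambda>(x, y). of_int (3 * y - x))"
  define n2 :: "lattice \<Rightarrow> complex" where "n2 = (\<lambda>(x, y). of_int x)"
  have sh1: "\<sigma> (m - simple_root N1) = e * \<sigma> m" "\<tau> (m - simple_root N1) = p * \<tau> m"
      "\<rho> (m - simple_root N1) = \<rho> m" "n0 (m - simple_root N1) = n0 m - 2"
      "n1 (m - simple_root N1) = n1 m - (- 1)" "n2 (m - simple_root N1) = n2 m - 1"
    and sh2: "\<sigma> (m - simple_root N2) = p\<^sup>2 * \<sigma> m" "\<tau> (m - simple_root N2) = e * \<tau> m"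
      "\<rho> (m - simple_root N2) = p * \<rho> m" "n0 (m - simple_root N2) = n0 m - (- 3)"
      "n1 (m - simple_root N2) = n1 m - 3" "n2 (m - simple_root N2) = n2 m - 0" for m
    using e by (auto simp: \<sigma>_def \<tau>_def \<rho>_def n0_def n1_def n2_def p_def power_int_diff
        power_int_add algebra_simps power2_eq_square divide_simps split: prod.splits)
  obtain s t r where str: "s = \<sigma> l" "t = \<tau> l" "r = \<rho> l" by simp
  obtain a b where XY: "a = complex_of_int x" "b = complex_of_int y" by simp
  note defs = \<sigma>_def \<tau>_def \<rho>_def n0_def n1_def n2_def
  let ?Q = "csc (e - inverse e) (\<Sum>m\<in>Poly_Mapping.keys f. csc (Poly_Mapping.lookup f m) (X_model e m u))"
  have Q: "?Q = (k * lin_ext \<sigma> f * a0 + k\<^sup>2 * lin_ext (\<lambda>m. \<sigma> m * n2 m) f * a5,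
     k * lin_ext \<tau> f * a1 + k\<^sup>2 * lin_ext (\<lambda>m. \<tau> m * n1 m) f * a4,
     k * lin_ext \<rho> f * a2 + k\<^sup>2 * lin_ext (\<lambda>m. \<rho> m * n0 m) f * a3,
     k * lin_ext \<rho> f * a3, k * lin_ext \<tau> f * a4, k * lin_ext \<sigma> f * a5)"
    unfolding u sum_X_model
    by (simp add: defs case_prod_unfold k_def p_def[symmetric] power2_eq_square algebra_simps)
  have k1: "k = - (1 + p) * (1 - e)" "k = (1 + e) * (1 - p)" "k = e * (1 - p\<^sup>2)"
    using p by (simp_all add: k_def algebra_simps power2_eq_square)
  have k2: "k\<^sup>2 = (1 + p)\<^sup>2 * (1 - e)\<^sup>2" "k\<^sup>2 = (1 + e)\<^sup>2 * (1 - p)\<^sup>2"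
    "k\<^sup>2 = e\<^sup>2 * (1 - p\<^sup>2)\<^sup>2"
    by (simp add: k1(1) power2_eq_square algebra_simps, simp only: k1(2) power_mult_distrib,
      simp only: k1(3) power_mult_distrib)
  show ?thesis
  proof (cases i)
    case N1
    have s1: "srefl i l = (3 * y - x, y)"
      by (simp add: N1 l srefl_def pairing_def scale_def)
    have w1: "\<sigma> (srefl i l) = t" "\<tau> (srefl i l) = s" "\<rho> (srefl i l) = r"
        "n0 (srefl i l) = 3 * b - 2 * a" "n1 (srefl i l) = a" "n2 (srefl i l) = 3 * b - a"
        "n0 l = 2 * a - 3 * b" "n1 l = 3 * b - a" "n2 l = a"
      unfolding s1 by (simp_all add: defs str XY l algebra_simps)
    note q = lin_ext_quot_weight[OF f] lin_ext_quot_weight_linear[OF f]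
    have "(1 - e) * lin_ext \<sigma> f = s - t"
      by (subst q(1)) (simp_all add: N1 sh1 e1 w1[unfolded N1] str del: simple_root.simps)
    then have S: "k * lin_ext \<sigma> f = - (1 + p) * (s - t)"
      unfolding k1(1) mult.assoc by simp
    have "(1 - p) * lin_ext \<tau> f = t - s"
      by (subst q(1)) (simp_all add: N1 sh1 e1 w1[unfolded N1] str del: simple_root.simps)
    then have T: "k * lin_ext \<tau> f = (1 + e) * (t - s)"
      unfolding k1(2) mult.assoc by simp
    have "(1 - e)\<^sup>2 * lin_ext (\<lambda>m. \<sigma> m * n2 m) f = (1 - e) * (s * a - t * (3 * b - a)) - 1 * e * (s - t)"
      by (subst q(2)[where \<nu> = 1]) (simp_all add: N1 sh1 e1 w1[unfolded N1] str[symmetric] del: simple_root.simps)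
    then have Sn: "k\<^sup>2 * lin_ext (\<lambda>m. \<sigma> m * n2 m) f =
        (1 + p)\<^sup>2 * ((1 - e) * (s * a - t * (3 * b - a)) - e * (s - t))"
      unfolding k2(1) mult.assoc by simp
    have "(1 - p)\<^sup>2 * lin_ext (\<lambda>m. \<tau> m * n1 m) f = (1 - p) * (t * (3 * b - a) - s * a) - (- 1) * p * (t - s)"
      by (subst q(2)[where \<nu> = "- 1"]) (simp_all add: N1 sh1 e1 w1[unfolded N1] str[symmetric] del: simple_root.simps)
    then have Tn: "k\<^sup>2 * lin_ext (\<lambda>m. \<tau> m * n1 m) f =
        (1 + e)\<^sup>2 * ((1 - p) * (t * (3 * b - a) - s * a) + p * (t - s))"
      unfolding k2(2) mult.assoc by simp
    (* rho is constant along alpha_1, so the antiderivatives of rho and of rho * n0 are rho times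
       polynomials in n0 of degree one and two. *)
    have R: "lin_ext \<rho> f = r * (2 * a - 3 * b)"
      by (subst lin_ext_telescope[OF f, where \<phi> = "\<lambda>m. \<rho> m * n0 m / 2"])
        (simp_all add: N1 sh1 w1[unfolded N1] str[symmetric] field_simps del: simple_root.simps)
    have Rn: "lin_ext (\<lambda>m. \<rho> m * n0 m) f = r * (2 * a - 3 * b)"
      by (subst lin_ext_telescope[OF f, where \<phi> = "\<lambda>m. \<rho> m * ((n0 m)\<^sup>2 + 2 * n0 m) / 4"])
        (simp_all add: N1 sh1 w1[unfolded N1] str[symmetric] field_simps power2_eq_square del: simple_root.simps)
    have XX: "X_model e l (b0, b1, b2, b3, b4, b5) = (s * (b0 + k * a * b5),
        t * (b1 + k * (3 * b - a) * b4), r * (b2 + k * (2 * a - 3 * b) * b3), r * b3, t * b4, s * b5)"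
      "X_model e (srefl i l) (b0, b1, b2, b3, b4, b5) = (t * (b0 + k * (3 * b - a) * b5),
        s * (b1 + k * a * b4), r * (b2 + k * (3 * b - 2 * a) * b3), r * b3, s * b4, t * b5)"
      for b0 b1 b2 b3 b4 b5
      by (simp_all add: s1, simp_all add: str XY l defs k_def p_def Let_def)
    have ep: "e * (p * z) = z" "e * p = 1" for z
      using p by (simp_all add: mult.assoc[symmetric])
    show ?thesis
      unfolding Q S T Sn Tn R Rn unfolding u N1
      by (simp add: XX[unfolded N1] Let_def p_def[symmetric])
        (simp add: k_def algebra_simps power2_eq_square ep)
  next
    case N2
    have s1: "srefl i l = (x, x - y)"
      by (simp add: N2 l srefl_def pairing_def scale_def)
    (* The weight s_2 t does not occur in the model: T_2 acts there by a scalar, and the terms with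
       w have to cancel. *)
    obtain w where w: "w = \<sigma> (srefl i l)" by simp
    have w1: "\<sigma> (srefl i l) = w" "\<tau> (srefl i l) = r" "\<rho> (srefl i l) = t"
        "n0 (srefl i l) = 3 * b - a" "n1 (srefl i l) = 2 * a - 3 * b" "n2 (srefl i l) = a"
        "n0 l = 2 * a - 3 * b" "n1 l = 3 * b - a" "n2 l = a"
      unfolding w s1 by (simp_all add: defs str XY l algebra_simps)
    note q = lin_ext_quot_weight[OF f] lin_ext_quot_weight_linear[OF f]
    have "(1 - p\<^sup>2) * lin_ext \<sigma> f = s - w"
      by (subst q(1)) (simp_all add: N2 sh2 e1 w1[unfolded N2] str del: simple_root.simps)
    then have S: "k * lin_ext \<sigma> f = e * (s - w)"
      unfolding k1(3) mult.assoc by simp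
    have "(1 - e) * lin_ext \<tau> f = t - r"
      by (subst q(1)) (simp_all add: N2 sh2 e1 w1[unfolded N2] str del: simple_root.simps)
    then have T: "k * lin_ext \<tau> f = - (1 + p) * (t - r)"
      unfolding k1(1) mult.assoc by simp
    have "(1 - p) * lin_ext \<rho> f = r - t"
      by (subst q(1)) (simp_all add: N2 sh2 e1 w1[unfolded N2] str del: simple_root.simps)
    then have R: "k * lin_ext \<rho> f = (1 + e) * (r - t)"
      unfolding k1(2) mult.assoc by simp
    have "(1 - p\<^sup>2)\<^sup>2 * lin_ext (\<lambda>m. \<sigma> m * n2 m) f = (1 - p\<^sup>2) * (s * a - w * a) - 0 * p\<^sup>2 * (s - w)"
      by (subst q(2)[where \<nu> = 0]) (simp_all add: N2 sh2 e1 w1[unfolded N2] str[symmetric] del: simple_root.simps)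
    then have Sn: "k\<^sup>2 * lin_ext (\<lambda>m. \<sigma> m * n2 m) f = k * e * (s * a - w * a)"
      unfolding k2(3) mult.assoc by (simp add: k1(3) power2_eq_square[of e])
    have "(1 - e)\<^sup>2 * lin_ext (\<lambda>m. \<tau> m * n1 m) f =
        (1 - e) * (t * (3 * b - a) - r * (2 * a - 3 * b)) - 3 * e * (t - r)"
      by (subst q(2)[where \<nu> = 3]) (simp_all add: N2 sh2 e1 w1[unfolded N2] str[symmetric] del: simple_root.simps)
    then have Tn: "k\<^sup>2 * lin_ext (\<lambda>m. \<tau> m * n1 m) f =
        (1 + p)\<^sup>2 * ((1 - e) * (t * (3 * b - a) - r * (2 * a - 3 * b)) - 3 * e * (t - r))"
      unfolding k2(1) mult.assoc by simp
    have "(1 - p)\<^sup>2 * lin_ext (\<lambda>m. \<rho> m * n0 m) f =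
        (1 - p) * (r * (2 * a - 3 * b) - t * (3 * b - a)) - (- 3) * p * (r - t)"
      by (subst q(2)[where \<nu> = "- 3"]) (simp_all add: N2 sh2 e1 w1[unfolded N2] str[symmetric] del: simple_root.simps)
    then have Rn: "k\<^sup>2 * lin_ext (\<lambda>m. \<rho> m * n0 m) f =
        (1 + e)\<^sup>2 * ((1 - p) * (r * (2 * a - 3 * b) - t * (3 * b - a)) + 3 * p * (r - t))"
      unfolding k2(2) mult.assoc by simp
    have XX: "X_model e l (b0, b1, b2, b3, b4, b5) = (s * (b0 + k * a * b5),
        t * (b1 + k * (3 * b - a) * b4), r * (b2 + k * (2 * a - 3 * b) * b3), r * b3, t * b4, s * b5)"
      "X_model e (srefl i l) (b0, b1, b2, b3, b4, b5) = (w * (b0 + k * a * b5),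
        r * (b1 + k * (2 * a - 3 * b) * b4), t * (b2 + k * (3 * b - a) * b3), t * b3, r * b4, w * b5)"
      for b0 b1 b2 b3 b4 b5
      by (simp_all add: s1, simp_all add: str w[unfolded s1] XY l defs k_def p_def Let_def)
    have ep: "e * (p * z) = z" "e * p = 1" for z
      using p by (simp_all add: mult.assoc[symmetric])
    show ?thesis
      unfolding Q S T Sn Tn R Rn unfolding u N2
      by (simp add: XX[unfolded N2] Let_def p_def[symmetric])
        (simp add: k_def algebra_simps power2_eq_square ep)
  qed
qed

section \<open>The free algebra, its Hecke ideal and its representations\<close>

lemma ideal_hecke_ideal: "ideal (hecke_ideal q) free_ring"
  unfolding hecke_ideal_def
  by (rule ring.genideal_ideal[OF ring_free_ring]) (simp add: free_ring_def)

lemma hecke_ideal_mult_right: "h \<in> hecke_ideal q \<Longrightarrow> h * a \<in> hecke_ideal q"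
  using ideal.I_r_closed[OF ideal_hecke_ideal, of h q a] by (simp add: free_ring_def)

lemma hecke_rels_in_ideal: "r \<in> hecke_rels q \<Longrightarrow> r \<in> hecke_ideal q"
  unfolding hecke_ideal_def
  using ring.genideal_self[OF ring_free_ring, of "hecke_rels q"] by (auto simp: free_ring_def)

lemma fscal_central: "fscal z * a = a * fscal z"
  by (induction a rule: poly_mapping_induct_single)
    (simp_all add: fscal_def mult_single distrib_left distrib_right mult.commute)

lemma fscal_left_commute: "a * (fscal z * b) = fscal z * (a * b)"
  by (metis fscal_central mult.assoc)

lemma fscal_add: "fscal (y + z) = fscal y + fscal z"
  by (simp add: fscal_def single_add)

lemma fscal_mult: "fscal (y * z) = fscal y * fscal z"
  by (simp add: fscal_def mult_single)

lemma fscal_0 [simp]: "fscal 0 = 0" and fscal_1 [simp]: "fscal 1 = 1"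
  by (simp_all add: fscal_def)

locale free_action = vector_space scale
  for scale :: "complex \<Rightarrow> 'u::ab_group_add \<Rightarrow> 'u" +
  fixes \<rho> :: "gen \<Rightarrow> 'u \<Rightarrow> 'u"
  assumes \<rho>_add: "\<rho> g (u + v) = \<rho> g u + \<rho> g v"
    and \<rho>_scale: "\<rho> g (scale z u) = scale z (\<rho> g u)"
begin

definition word_act :: "word \<Rightarrow> 'u \<Rightarrow> 'u" where
  "word_act w = foldr \<rho> (case w of Word gs \<Rightarrow> gs)"

definition act :: "free_alg \<Rightarrow> 'u \<Rightarrow> 'u" where
  "act a u = (\<Sum>w\<in>Poly_Mapping.keys a. scale (Poly_Mapping.lookup a w) (word_act w u))"

lemma word_act_plus: "word_act (v + w) u = word_act v (word_act w u)"
  by (cases v; cases w) (simp add: word_act_def)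

lemma word_act_linear: "word_act w (u + v) = word_act w u + word_act w v"
  "word_act w (scale z u) = scale z (word_act w u)"
proof -
  obtain gs where "w = Word gs" by (cases w)
  moreover have "foldr \<rho> gs (u + v) = foldr \<rho> gs u + foldr \<rho> gs v"
    and "foldr \<rho> gs (scale z u) = scale z (foldr \<rho> gs u)"
    by (induction gs) (simp_all add: \<rho>_add \<rho>_scale)
  ultimately show "word_act w (u + v) = word_act w u + word_act w v"
    and "word_act w (scale z u) = scale z (word_act w u)"
    by (simp_all add: word_act_def)
qed

lemma act_superset:
  "finite A \<Longrightarrow> Poly_Mapping.keys a \<subseteq> A \<Longrightarrow>
    act a u = (\<Sum>w\<in>A. scale (Poly_Mapping.lookup a w) (word_act w u))"
  unfolding act_def by (rule sum.mono_neutral_left) (auto simp: in_keys_iff)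

lemma act_add: "act (a + b) u = act a u + act b u"
proof -
  let ?A = "Poly_Mapping.keys a \<union> Poly_Mapping.keys b"
  have "Poly_Mapping.keys (a + b) \<subseteq> ?A" by (rule Poly_Mapping.keys_add)
  then show ?thesis
    by (simp add: act_superset[of ?A] lookup_add scale_left_distrib sum.distrib)
qed

lemma act_0 [simp]: "act 0 u = 0"
  by (simp add: act_def)

lemma act_minus: "act (- a) u = - act a u"
  by (simp add: act_def sum_negf)

lemma act_diff: "act (a - b) u = act a u - act b u"
  using act_add[of a "- b" u] by (simp add: act_minus)

lemma act_sum: "act (sum f A) u = (\<Sum>x\<in>A. act (f x) u)"
  by (induction A rule: infinite_finite_induct) (auto simp: act_add)

lemma act_single: "act (Poly_Mapping.single w z) u = scale z (word_act w u)"
  by (simp add: act_def)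

lemma act_right_linear: "act a (u + v) = act a u + act a v"
  "act a (scale z u) = scale z (act a u)"
  by (simp_all add: act_def word_act_linear scale_right_distrib sum.distrib scale_sum_right
      mult.commute)

lemma act_right_0 [simp]: "act a 0 = 0"
  using act_right_linear(2)[of a 0 0] by simp

lemma act_mult: "act (a * b) u = act a (act b u)"
proof (induction a rule: poly_mapping_induct_single)
  case (single w z)
  show ?case
    by (induction b rule: poly_mapping_induct_single)
      (simp_all add: distrib_left act_add act_right_linear mult_single act_single word_act_plus
        word_act_linear act_right_0)
qed (simp_all add: distrib_right act_add)

lemma act_fscal [simp]: "act (fscal z) u = scale z u"
  by (simp add: fscal_def act_single word_act_def zero_word_def)

lemma act_1 [simp]: "act 1 u = u"
  by (simp flip: single_one add: act_single word_act_def zero_word_def)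

lemma act_fgen [simp]: "act (fgen g) u = \<rho> g u"
  by (simp add: fgen_def act_single word_act_def)

lemma act_fpoly:
  "act (fpoly f) u = (\<Sum>l\<in>Poly_Mapping.keys f. scale (Poly_Mapping.lookup f l) (\<rho> (GenX l) u))"
  by (simp add: fpoly_def act_sum act_mult)

lemma act_hecke_ideal:
  assumes rels: "\<And>r u. r \<in> hecke_rels q \<Longrightarrow> act r u = 0" and a: "a \<in> hecke_ideal q"
  shows "act a u = 0"
proof -
  interpret F: ring free_ring by (rule ring_free_ring)
  let ?I = "{a. \<forall>u. act a u = 0}"
  have "ideal ?I free_ring"
  proof (rule idealI[OF ring_free_ring])
    have inv: "inv\<^bsub>add_monoid free_ring\<^esub> a = - a" for a
      by (rule group.inv_equality[OF F.add.is_group]) (simp_all add: free_ring_def)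
    show "subgroup ?I (add_monoid free_ring)"
      by (rule group.subgroupI[OF F.add.is_group])
        (auto simp: inv[unfolded free_ring_def, simplified] free_ring_def act_add act_minus
          intro: exI[of _ 0])
    show "x \<otimes>\<^bsub>free_ring\<^esub> a \<in> ?I" "a \<otimes>\<^bsub>free_ring\<^esub> x \<in> ?I"
      if "a \<in> ?I" "x \<in> carrier free_ring" for a x
      using that by (auto simp: free_ring_def act_mult)
  qed
  then have "hecke_ideal q \<subseteq> ?I"
    unfolding hecke_ideal_def by (rule F.genideal_minimal) (use rels in blast)
  then show ?thesis using a by blast
qed

end

text \<open>
  The algebra has parameter \<open>q = \<epsilon> e\<close>; the sign is put back into the \<open>T\<^sub>i\<close> here.
\<close>

fun gen_model :: "complex \<Rightarrow> complex \<Rightarrow> gen \<Rightarrow> vec6 \<Rightarrow> vec6" where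
  "gen_model \<epsilon> e (GenT i) u = csc \<epsilon> (T_model e i u)"
| "gen_model \<epsilon> e (GenX l) u = X_model e l u"

interpretation model: free_action csc "gen_model \<epsilon> e" for \<epsilon> e
proof
  show "gen_model \<epsilon> e g (u + v) = gen_model \<epsilon> e g u + gen_model \<epsilon> e g v" for g u v
    by (cases g) (simp_all add: T_model_linear X_model_linear vec6.scale_right_distrib)
  show "gen_model \<epsilon> e g (csc z u) = csc z (gen_model \<epsilon> e g u)" for g u z
    by (cases g) (simp_all only: gen_model.simps T_model_linear X_model_linear vec6.scale_left_commute)
qed

lemma model_hecke_rels:
  assumes "e \<noteq> 0" "e\<^sup>2 \<noteq> 1" "\<epsilon>\<^sup>2 = 1" "r \<in> hecke_rels (\<epsilon> * e)"
  shows "model.act \<epsilon> e r u = 0"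
proof -
  have \<epsilon>: "\<epsilon> * \<epsilon> = 1" using assms by (simp add: power2_eq_square)
  then have "inverse \<epsilon> = \<epsilon>" by (metis inverse_unique)
  then have q: "\<epsilon> * e - inverse (\<epsilon> * e) = \<epsilon> * (e - inverse e)"
    by (simp add: algebra_simps)
  consider i where "r = fgen (GenT i) ^ 2 - (fscal (\<epsilon> * (e - inverse e)) * fgen (GenT i) + 1)"
    | "r = (fgen (GenT N1) * fgen (GenT N2)) ^ 3 - (fgen (GenT N2) * fgen (GenT N1)) ^ 3"
    | "r = fgen (GenX 0) - 1"
    | l m where "r = fgen (GenX l) * fgen (GenX m) - fgen (GenX (l + m))"
    | l i f where "is_quot i l f" "r = fgen (GenX l) * fgen (GenT i)
        - (fgen (GenT i) * fgen (GenX (srefl i l)) + fscal (\<epsilon> * (e - inverse e)) * fpoly f)"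
    using assms(4) unfolding hecke_rels_def q by blast
  then show ?thesis
  proof cases
    case 1
    then show ?thesis
      by (simp add: model.act_diff model.act_add model.act_mult power2_eq_square T_model_linear
          T_model_quadratic[OF \<open>e \<noteq> 0\<close>] vec6.scale_right_distrib \<epsilon> mult.left_commute)
  next
    case 2
    then show ?thesis
      using T_model_braid[OF \<open>e \<noteq> 0\<close>]
      by (simp add: model.act_diff model.act_mult power3_eq_cube T_model_linear)
  next
    case 3
    then show ?thesis by (simp add: model.act_diff X_model_0)
  next
    case 4
    then show ?thesis by (simp add: model.act_diff model.act_mult X_model_add[OF \<open>e \<noteq> 0\<close>])
  next
    case (5 l i f)
    then show ?thesis
      by (simp add: model.act_diff model.act_add model.act_mult model.act_fpoly X_model_linear
          X_T_model[OF 5(1) assms(1,2)] vec6.scale_right_distrib)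
  qed
qed

section \<open>Irreducibility of the model\<close>

text \<open>
  The operator \<open>X\<^bsup>\<alpha>\<^sub>1\<^esup>\<close> has the distinct eigenvalues \<open>1, e, e\<^sup>-\<^sup>1\<close> on the three generalised weight
  spaces, so products of \<open>X\<^bsup>\<alpha>\<^sub>1\<^esup> - z\<close> project an invariant subspace to them. On the \<open>t'\<close>-space
  \<open>X\<^bsup>\<alpha>\<^sub>1\<^esup> - 1\<close> maps \<open>g'\<close> to \<open>2 k g\<close>, and \<open>k \<noteq> 0\<close>; hence a vector with nonzero component there
  produces the weight vector \<open>g\<close>. A vector without such a component acquires one under
  \<open>T\<^sub>2\<close>, or \<open>T\<^sub>1\<close> followed by \<open>T\<^sub>2\<close>. From \<open>g\<close> one returns to \<open>f\<close> and \<open>m\<close>, dividing by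
  \<open>1 - c \<noteq> 0\<close> each time.
\<close>

lemma model_irreducible:
  assumes e: "e \<noteq> 0" "e\<^sup>2 \<noteq> 1" "e\<^sup>2 + e + 1 \<noteq> 0"
    and add: "\<And>u v. u \<in> K \<Longrightarrow> v \<in> K \<Longrightarrow> u + v \<in> K"
    and csc: "\<And>z u. u \<in> K \<Longrightarrow> csc z u \<in> K"
    and X: "\<And>l u. u \<in> K \<Longrightarrow> X_model e l u \<in> K"
    and T: "\<And>i u. u \<in> K \<Longrightarrow> T_model e i u \<in> K"
    and u: "u \<in> K" "u \<noteq> 0"
  shows "(1, 0, 0, 0, 0, 0) \<in> K"
proof -
  define p where "p = inverse e"
  define k where "k = e - p"
  define c where "c = e + 2 + p"
  have "e * p = 1" using e by (simp add: p_def)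
  have k: "k \<noteq> 0" and e1: "1 - e \<noteq> 0" and p1: "1 - p \<noteq> 0"
    using e \<open>e * p = 1\<close> by (auto simp: k_def power2_eq_square)
  have "e * (1 - c) = - (e\<^sup>2 + e + 1)" 
    using \<open>e * p = 1\<close> by (simp add: c_def algebra_simps power2_eq_square)
  then have c: "1 - c \<noteq> 0" using e(3) by (metis mult_zero_right neg_equal_0_iff_equal)
  (* D z is the action of X^alpha_1 - z. *)
  define D where "D z u = X_model e (1, 0) u + csc (- z) u" for z u
  have D_in: "D z u \<in> K" if "u \<in> K" for z u unfolding D_def by (intro add csc X that)
  have D: "D z (a0, a1, a2, a3, a4, a5) = ((p - z) * a0 + p * k * a5, (e - z) * a1 - e * k * a4,
      (1 - z) * a2 + 2 * k * a3, (1 - z) * a3, (e - z) * a4, (p - z) * a5)" for z a0 a1 a2 a3 a4 a5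
    by (simp add: D_def Let_def p_def k_def power_int_minus algebra_simps)
  have divide: "(a0, a1, a2, a3, a4, a5) \<in> K" if "csc z (a0, a1, a2, a3, a4, a5) \<in> K" "z \<noteq> 0"
    for z a0 a1 a2 a3 a4 a5
    using csc[OF that(1), of "inverse z"] that(2) by (simp add: mult.assoc[symmetric])
  have T1: "T_model e N1 (a0, a1, a2, a3, a4, a5) =
     (- (1 + p) * a0 - c * a5 + (1 - c) * a1 - c\<^sup>2 * a4, a0 + (e + 1) * a1 + c * a4, a3,
      a2 + k * a3, a5 + (e + 1) * a4, - (1 + p) * a5 + (1 - c) * a4)"
    and T2: "T_model e N2 (a0, a1, a2, a3, a4, a5) =
     (e * a0, - (1 + p) * a1 - 3 * c * a4 + (1 - c) * a2 - 3 * c\<^sup>2 * a3,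
      a1 + (e + 1) * a2 + 3 * c * a3, a4 + (e + 1) * a3, - (1 + p) * a4 + (1 - c) * a3, e * a5)"
    for a0 a1 a2 a3 a4 a5
    by (simp_all add: Let_def p_def k_def c_def)
  have g: "(0, 0, 1, 0, 0, 0) \<in> K" if "(a0, a1, a2, a3, a4, a5) \<in> K" "a2 \<noteq> 0 \<or> a3 \<noteq> 0"
    for a0 a1 a2 a3 a4 a5
  proof -
    (* The squares kill the other two generalised weight spaces. *)
    let ?v = "D p (D p (D e (D e (a0, a1, a2, a3, a4, a5))))"
    have v: "?v \<in> K" by (intro D_in that)
    show ?thesis
    proof (cases "a3 = 0")
      case True
      have "?v = csc ((1 - p)\<^sup>2 * (1 - e)\<^sup>2 * a2) (0, 0, 1, 0, 0, 0)"
        by (simp add: D True power2_eq_square)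
      then show ?thesis using v that(2) True e1 p1
        by (intro divide[of "(1 - p)\<^sup>2 * (1 - e)\<^sup>2 * a2"]) (auto simp del: csc_simp)
    next
      case False
      have "D 1 ?v = csc (2 * k * (1 - p)\<^sup>2 * (1 - e)\<^sup>2 * a3) (0, 0, 1, 0, 0, 0)"
        by (simp add: D power2_eq_square)
      then show ?thesis using D_in[OF v, of 1] False k e1 p1
        by (intro divide[of "2 * k * (1 - p)\<^sup>2 * (1 - e)\<^sup>2 * a3"]) (auto simp del: csc_simp)
    qed
  qed
  have g': "(0, 0, 1, 0, 0, 0) \<in> K" if "(a0, a1, a2, a3, a4, a5) \<in> K"
      "a1 \<noteq> 0 \<or> a2 \<noteq> 0 \<or> a3 \<noteq> 0 \<or> a4 \<noteq> 0"
    for a0 a1 a2 a3 a4 a5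
  proof (cases "a2 \<noteq> 0 \<or> a3 \<noteq> 0")
    case True
    then show ?thesis by (rule g[OF that(1)])
  next
    case False
    then show ?thesis using g[OF T[OF that(1), of N2, unfolded T2]] that(2) by auto
  qed
  obtain a0 a1 a2 a3 a4 a5 where u': "u = (a0, a1, a2, a3, a4, a5)" by (cases u) auto
  have g_in: "(0, 0, 1, 0, 0, 0) \<in> K"
  proof (cases "a1 \<noteq> 0 \<or> a2 \<noteq> 0 \<or> a3 \<noteq> 0 \<or> a4 \<noteq> 0")
    case True
    then show ?thesis using g' u(1) unfolding u' by blast
  next
    case False
    then have "a0 \<noteq> 0 \<or> a5 \<noteq> 0" using u(2) unfolding u' zero_prod_def by auto
    then show ?thesis using g'[OF T[OF u(1)[unfolded u'], of N1, unfolded T1]] False by auto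
  qed
  have "T_model e N2 (0, 0, 1, 0, 0, 0) + csc (- (e + 1)) (0, 0, 1, 0, 0, 0) =
      csc (1 - c) (0, 1, 0, 0, 0, 0)"
    unfolding T2 by simp
  then have f_in: "(0, 1, 0, 0, 0, 0) \<in> K"
    using add[OF T[OF g_in] csc[OF g_in]] c by (metis divide)
  have "T_model e N1 (0, 1, 0, 0, 0, 0) + csc (- (e + 1)) (0, 1, 0, 0, 0, 0) =
      csc (1 - c) (1, 0, 0, 0, 0, 0)"
    unfolding T1 by simp
  then show ?thesis
    using add[OF T[OF f_in] csc[OF f_in]] c by (metis divide)
qed

section \<open>Words for the cosets of the parabolic subgroup\<close>

text \<open>
  \<open>T_coset j\<close> for \<open>j < 6\<close> is \<open>T\<^sub>w\<close> for the minimal representative \<open>w\<close> of length \<open>j\<close> of a coset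
  of \<open>\<langle>s\<^sub>2\<rangle>\<close> in the Weyl group: \<open>1\<close>, \<open>T\<^sub>1\<close>, \<open>T\<^sub>2 T\<^sub>1\<close>, and so on.
\<close>

definition alt_node :: "nat \<Rightarrow> node" where
  "alt_node j = (if even j then N1 else N2)"

primrec T_coset :: "nat \<Rightarrow> free_alg" where
  "T_coset 0 = 1"
| "T_coset (Suc j) = fgen (GenT (alt_node j)) * T_coset j"

text \<open>
  In the application \<open>L\<close> is the annihilator of a vector \<open>v\<close> with \<open>T\<^sub>2 v = c v\<close> and
  \<open>X\<^sup>\<lambda> v = t(\<lambda>) v\<close> in a module of the affine Hecke algebra, and the claim is that the six vectors
  \<open>T_coset j v\<close> span the submodule generated by \<open>v\<close>. Let \<open>D n\<close> be the span of the first \<open>n\<close> of them. It is stable under the \<open>X\<^sup>\<lambda>\<close>,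
  since the cross relation moves \<open>X\<^sup>\<lambda>\<close> past \<open>T\<^sub>i\<close> at the cost of terms in \<open>D n\<close>, and \<open>T\<^sub>i\<close> maps it
  to \<open>D (n + 1)\<close>. At \<open>n = 6\<close> the chain stops because of the braid relation:
  \<open>T\<^sub>2 T\<^sub>1 T\<^sub>2 T\<^sub>1 T\<^sub>2 T\<^sub>1 v = T\<^sub>1 T\<^sub>2 T\<^sub>1 T\<^sub>2 T\<^sub>1 T\<^sub>2 v = c T\<^sub>1 T\<^sub>2 T\<^sub>1 T\<^sub>2 T\<^sub>1 v\<close>.
\<close>

lemma T_coset_spanning:
  assumes L_add: "\<And>a b. a \<in> L \<Longrightarrow> b \<in> L \<Longrightarrow> a + b \<in> L"
    and L_mult: "\<And>a b. b \<in> L \<Longrightarrow> a * b \<in> L"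
    and L_rels: "hecke_ideal q \<subseteq> L"
    and L_T: "fgen (GenT N2) - fscal c \<in> L"
    and L_X: "\<And>l. fgen (GenX l) - fscal (t l) \<in> L"
  shows "\<exists>z. a - (\<Sum>j<6. fscal (z j) * T_coset j) \<in> L"
proof -
  define D where "D n = {a. \<exists>z. a - (\<Sum>j<n. fscal (z j) * T_coset j) \<in> L}" for n
  have L_0: "0 \<in> L" using L_mult[OF L_T, of 0] by simp
  have L_minus: "- a \<in> L" if "a \<in> L" for a using L_mult[OF that, of "- 1"] by simp
  have rel: "r * b \<in> L" if "r \<in> hecke_rels q" for r b
    using that hecke_rels_in_ideal hecke_ideal_mult_right L_rels by blast
  have D_add: "a + b \<in> D n" if "a \<in> D n" "b \<in> D n" for a b n
  proof -
    from that obtain y z where "a - (\<Sum>j<n. fscal (y j) * T_coset j) \<in> L" "b - (\<Sum>j<n. fscal (z j) * T_coset j) \<in> L"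
      unfolding D_def by blast
    from L_add[OF this] have "(a + b) - (\<Sum>j<n. fscal (y j + z j) * T_coset j) \<in> L"
      by (simp add: fscal_add distrib_right sum.distrib algebra_simps)
    then show ?thesis unfolding D_def by (intro CollectI exI[of _ "\<lambda>j. y j + z j"])
  qed
  have D_scale: "fscal w * a \<in> D n" if "a \<in> D n" for w a n
  proof -
    from that obtain z where "a - (\<Sum>j<n. fscal (z j) * T_coset j) \<in> L"
      unfolding D_def by blast
    from L_mult[OF this, of "fscal w"] have "fscal w * a - (\<Sum>j<n. fscal (w * z j) * T_coset j) \<in> L"
      by (simp add: fscal_mult right_diff_distrib sum_distrib_left mult.assoc)
    then show ?thesis unfolding D_def by (intro CollectI exI[of _ "\<lambda>j. w * z j"])
  qed
  have D_L: "a \<in> D n" if "a \<in> L" for a n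
    unfolding D_def using that by (intro CollectI exI[of _ "\<lambda>j. 0"]) simp
  have D_sum: "sum f A \<in> D n" if "\<And>x. x \<in> A \<Longrightarrow> f x \<in> D n" for f :: "'x \<Rightarrow> free_alg" and A n
    using that by (induction A rule: infinite_finite_induct) (auto intro: D_add D_L L_0)
  have D_cong: "a \<in> D n" if "a - b \<in> L" "b \<in> D n" for a b n
    using D_add[OF D_L[OF that(1)] that(2)] by simp
  have D_T_coset: "T_coset j \<in> D n" if "j < n" for j n
  proof -
    have "(\<Sum>i<n. fscal (of_bool (i = j)) * T_coset i) = (\<Sum>i\<in>{j}. T_coset i)"
      by (rule sum.mono_neutral_cong_right) (use that in auto)
    then show ?thesis unfolding D_def
      by (intro CollectI exI[of _ "\<lambda>i. of_bool (i = j)"]) (simp add: L_0)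
  qed
  have D_left: "g * a \<in> D m" if "\<And>j. j < n \<Longrightarrow> g * T_coset j \<in> D m" "a \<in> D n" for g a m n
  proof -
    from that(2) obtain z where z: "a - (\<Sum>j<n. fscal (z j) * T_coset j) \<in> L"
      unfolding D_def by blast
    have "g * a - (\<Sum>j<n. fscal (z j) * (g * T_coset j)) \<in> L"
      using L_mult[OF z, of g] by (simp add: right_diff_distrib sum_distrib_left fscal_left_commute)
    then show ?thesis by (rule D_cong) (intro D_sum D_scale that(1), simp)
  qed
  have D_mono: "a \<in> D n" if "a \<in> D m" "m \<le> n" for a m n
    using D_left[of m 1 n a] D_T_coset that by simp
  have D_T': "fgen (GenT i) * T_coset j \<in> D (Suc j)" if "i \<noteq> alt_node j" for i j
  proof (cases j)
    case 0
    then have "i = N2" using that by (cases i) (auto simp: alt_node_def)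
    then have "fgen (GenT i) * T_coset j - fscal c * T_coset j \<in> L" using L_T 0 by simp
    then show ?thesis by (rule D_cong) (intro D_scale D_T_coset, simp)
  next
    case (Suc j')
    then have i: "i = alt_node j'"
      using that by (cases i; cases "even j'"; simp add: Suc alt_node_def)
    have "fgen (GenT i) ^ 2 - (fscal (q - inverse q) * fgen (GenT i) + 1) \<in> hecke_rels q"
      unfolding hecke_rels_def by blast
    from rel[OF this, of "T_coset j'"]
    have "fgen (GenT i) * T_coset j - (fscal (q - inverse q) * T_coset j + T_coset j') \<in> L"
      by (simp add: Suc i power2_eq_square algebra_simps)
    then show ?thesis by (rule D_cong) (intro D_add D_scale D_T_coset; simp add: Suc)
  qed
  have D_T: "fgen (GenT i) * T_coset j \<in> D (Suc (Suc j))" for i j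
  proof (cases "i = alt_node j")
    case True
    then show ?thesis using D_T_coset[of "Suc j" "Suc (Suc j)"] by simp
  next
    case False
    then show ?thesis using D_T'[of i j] D_mono by simp
  qed
  have D_X: "fgen (GenX l) * T_coset j \<in> D (Suc j)" for l j
  proof (induction j arbitrary: l)
    case 0
    have "fgen (GenX l) * T_coset 0 - fscal (t l) * T_coset 0 \<in> L" using L_X by simp
    then show ?case by (rule D_cong) (intro D_scale D_T_coset, simp)
  next
    case (Suc j)
    define i where "i = alt_node j"
    obtain f where f: "is_quot i l f" using quot_unique_exists by blast
    have "fgen (GenX l) * fgen (GenT i) - (fgen (GenT i) * fgen (GenX (srefl i l))
        + fscal (q - inverse q) * fpoly f) \<in> hecke_rels q"
      unfolding hecke_rels_def using f by blast
    from rel[OF this, of "T_coset j"]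
    have "fgen (GenX l) * T_coset (Suc j) - (fgen (GenT i) * (fgen (GenX (srefl i l)) * T_coset j)
        + fscal (q - inverse q) * (fpoly f * T_coset j)) \<in> L"
      by (simp add: i_def algebra_simps)
    moreover have "fgen (GenT i) * (fgen (GenX (srefl i l)) * T_coset j) \<in> D (Suc (Suc j))"
      by (rule D_left[OF _ Suc.IH]) (rule D_mono[OF D_T], simp)
    moreover have "fpoly f * T_coset j \<in> D (Suc (Suc j))"
      unfolding fpoly_def sum_distrib_right mult.assoc
      by (intro D_sum D_scale D_mono[OF Suc.IH]) simp
    ultimately show ?case by (rule D_cong[OF _ D_add[OF _ D_scale]])
  qed
  have D_T6: "fgen (GenT i) * T_coset j \<in> D 6" if "j < 6" for i j
  proof (cases "j < 5 \<or> i \<noteq> alt_node j")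
    case True
    then show ?thesis using D_mono[OF D_T, of j 6 i] D_mono[OF D_T', of i j 6] that by auto
  next
    case False
    then have j: "j = 5" and i: "i = N2" using that by (auto simp: alt_node_def)
    let ?T = "fgen (GenT N1)" and ?S = "fgen (GenT N2)"
    have T5: "T_coset 5 = ?T * ?S * ?T * ?S * ?T"
    proof -
      have "(5::nat) = Suc (Suc (Suc (Suc (Suc 0))))" by simp
      then show ?thesis
        by (simp only: T_coset.simps alt_node_def) (simp add: mult.assoc)
    qed
    have "(?T * ?S) ^ 3 - (?S * ?T) ^ 3 \<in> L"
      using rel[of "(?T * ?S) ^ 3 - (?S * ?T) ^ 3" 1] by (simp add: hecke_rels_def)
    then have "- ((?T * ?S) ^ 3 - (?S * ?T) ^ 3) + T_coset 5 * (?S - fscal c) \<in> L"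
      by (intro L_add L_minus L_mult L_T)
    also have "- ((?T * ?S) ^ 3 - (?S * ?T) ^ 3) + T_coset 5 * (?S - fscal c) =
        ?S * T_coset 5 - fscal c * T_coset 5"
      unfolding fscal_central[of c "T_coset 5"] by (simp add: T5 power3_eq_cube algebra_simps)
    finally have "?S * T_coset 5 - fscal c * T_coset 5 \<in> L" .
    then show ?thesis unfolding i j by (rule D_cong) (intro D_scale D_T_coset, simp)
  qed
  have D_gen: "fgen g * a \<in> D 6" if "a \<in> D 6" for g a
    by (rule D_left[OF _ that]; cases g; simp add: D_T6 D_mono[OF D_X])
  have D_word: "Poly_Mapping.single (Word gs) z \<in> D 6" for gs z
  proof (induction gs)
    case Nil
    then show ?case
      using D_scale[OF D_T_coset[of 0 6], of z] by (simp add: fscal_def zero_word_def)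
  next
    case (Cons g gs)
    then show ?case using D_gen[OF Cons, of g] by (simp add: fgen_def mult_single)
  qed
  have "a \<in> D 6"
  proof (induction a rule: poly_mapping_induct_single)
    case (single w z)
    then show ?case using D_word by (cases w) simp
  qed (auto intro: D_L L_0 D_add)
  then show ?thesis by (simp add: D_def)
qed

text \<open>
  In the order \<open>m, f, g, g', f', m'\<close> of the basis, the vectors \<open>T_coset j m\<close> are triangular with
  diagonal entries that are products of powers of \<open>\<epsilon>\<close> and \<open>1 - c\<close>.
\<close>

lemma T_coset_independent:
  assumes e: "e \<noteq> 0" "e\<^sup>2 + e + 1 \<noteq> 0" and "\<epsilon> \<noteq> 0"
    and sum: "model.act \<epsilon> e (\<Sum>j<6. fscal (z j) * T_coset j) (1, 0, 0, 0, 0, 0) = 0"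
    and "j < 6"
  shows "z j = 0"
proof -
  define p where "p = inverse e"
  define c where "c = e + 2 + p"
  have "e * p = 1" using e by (simp add: p_def)
  then have "e * (1 - c) = - (e\<^sup>2 + e + 1)" 
    by (simp add: c_def algebra_simps power2_eq_square)
  then have c: "1 - c \<noteq> 0" using e(2) by (metis mult_zero_right neg_equal_0_iff_equal)
  have T: "T_model e N1 (a0, a1, a2, a3, a4, a5) =
     (- (1 + p) * a0 - c * a5 + (1 - c) * a1 - c\<^sup>2 * a4, a0 + (e + 1) * a1 + c * a4, a3,
      a2 + (e - p) * a3, a5 + (e + 1) * a4, - (1 + p) * a5 + (1 - c) * a4)"
     "T_model e N2 (a0, a1, a2, a3, a4, a5) =
     (e * a0, - (1 + p) * a1 - 3 * c * a4 + (1 - c) * a2 - 3 * c\<^sup>2 * a3,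
      a1 + (e + 1) * a2 + 3 * c * a3, a4 + (e + 1) * a3, - (1 + p) * a4 + (1 - c) * a3, e * a5)"
    for a0 a1 a2 a3 a4 a5
    by (simp_all add: Let_def p_def c_def)
  define w where "w j = model.act \<epsilon> e (T_coset j) (1, 0, 0, 0, 0, 0)" for j
  have w_Suc: "w (Suc j) = csc \<epsilon> (T_model e (alt_node j) (w j))" for j
    by (simp add: w_def model.act_mult)
  have w_step: "w 1 = csc \<epsilon> (T_model e N1 (w 0))" "w 2 = csc \<epsilon> (T_model e N2 (w 1))"
    "w 3 = csc \<epsilon> (T_model e N1 (w 2))" "w 4 = csc \<epsilon> (T_model e N2 (w 3))"
    "w 5 = csc \<epsilon> (T_model e N1 (w 4))"
    using w_Suc[of 0] w_Suc[of 1] w_Suc[of 2] w_Suc[of 3] w_Suc[of 4]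
    by (simp_all add: alt_node_def flip: numeral_2_eq_2)
  have w0: "w 0 = (1, 0, 0, 0, 0, 0)" by (simp add: w_def)
  (* Only the last nonzero coordinate of each vector matters. *)
  obtain x0 where w1: "w 1 = (x0, \<epsilon>, 0, 0, 0, 0)"
    using w_step(1) unfolding w0 by (simp add: T eval_nat_numeral del: T_model.simps)
  obtain x0 x1 where w2: "w 2 = (x0, x1, \<epsilon>\<^sup>2, 0, 0, 0)"
    using w_step(2) unfolding w1 by (simp add: T eval_nat_numeral del: T_model.simps)
  obtain x0 x1 where w3: "w 3 = (x0, x1, 0, \<epsilon> ^ 3, 0, 0)"
    using w_step(3) unfolding w2 by (simp add: T eval_nat_numeral del: T_model.simps)
  obtain x0 x1 x2 x3 where w4: "w 4 = (x0, x1, x2, x3, \<epsilon> ^ 4 * (1 - c), 0)"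
    using w_step(4) unfolding w3 by (simp add: T eval_nat_numeral del: T_model.simps)
  obtain x0 x1 x2 x3 x4 where w5: "w 5 = (x0, x1, x2, x3, x4, \<epsilon> ^ 5 * (1 - c)\<^sup>2)"
    using w_step(5) unfolding w4 by (simp add: T eval_nat_numeral del: T_model.simps)
  have "(\<Sum>j<6. csc (z j) (w j)) = 0"
    using sum by (simp add: model.act_sum model.act_mult w_def)
  also have "{..<6} = {0, 1, 2, 3, 4, 5 :: nat}" by auto
  finally have s: "csc (z 0) (w 0) + csc (z 1) (w 1) + csc (z 2) (w 2) + csc (z 3) (w 3)
      + csc (z 4) (w 4) + csc (z 5) (w 5) = 0"
    by (simp add: add.assoc)
  note s = s[unfolded w0 w1 w2 w3 w4 w5]
  have 5: "z 5 = 0" using s c \<open>\<epsilon> \<noteq> 0\<close> by (simp add: zero_prod_def)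
  have 4: "z 4 = 0" using s c \<open>\<epsilon> \<noteq> 0\<close> by (simp add: zero_prod_def 5)
  have 3: "z 3 = 0" using s c \<open>\<epsilon> \<noteq> 0\<close> by (simp add: zero_prod_def 5 4)
  have 2: "z 2 = 0" using s c \<open>\<epsilon> \<noteq> 0\<close> by (simp add: zero_prod_def 5 4 3)
  have 1: "z 1 = 0" using s c \<open>\<epsilon> \<noteq> 0\<close> by (simp add: zero_prod_def 5 4 3 2)
  have 0: "z 0 = 0" using s c \<open>\<epsilon> \<noteq> 0\<close>
    by (auto simp: zero_prod_def 5 4 3 2)
  have "j = 0 \<or> j = 1 \<or> j = 2 \<or> j = 3 \<or> j = 4 \<or> j = 5" using \<open>j < 6\<close> by auto
  then show ?thesis using 0 1 2 3 4 5 by auto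
qed

section \<open>The tensor product over a subring\<close>

locale tensor_product = R?: ring R + V?: abelian_group V
  for R :: "('a, 'c) ring_scheme" (structure) and S :: "'a set" and V :: "('a, 'v, 'm) module_scheme" +
  assumes scalars_subset: "S \<subseteq> carrier R"
    and scalars_act: "\<lbrakk>s \<in> S; v \<in> carrier V\<rbrakk> \<Longrightarrow> s \<odot>\<^bsub>V\<^esub> v \<in> carrier V"
begin

abbreviation "F \<equiv> free_Abelian_group (carrier R \<times> carrier V)"

definition "N = generate F (tensor_rels R S V)"

abbreviation "M \<equiv> induced_module R S V"

definition tensor :: "'a \<Rightarrow> 'v \<Rightarrow> ('a \<times> 'v \<Rightarrow>\<^sub>0 int) set" (infix \<open>\<otimes>\<^sub>t\<close> 71) where
  "a \<otimes>\<^sub>t v = N #>\<^bsub>F\<^esub> frag_of (a, v)"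

text \<open>
  The action of \<open>r\<close> on representatives of classes in the tensor product.
\<close>

definition push :: "'a \<Rightarrow> ('a \<times> 'v \<Rightarrow>\<^sub>0 int) \<Rightarrow> ('a \<times> 'v \<Rightarrow>\<^sub>0 int)" where
  "push r = frag_extend (\<lambda>(a, v). frag_of (r \<otimes> a, v))"

lemma F_add: "x \<in> carrier F \<Longrightarrow> y \<in> carrier F \<Longrightarrow> x + y \<in> carrier F"
  using monoid.m_closed[OF group.is_monoid[OF group_free_Abelian_group]] by (metis mult_free_Abelian_group)

lemma F_minus: "x \<in> carrier F \<Longrightarrow> - x \<in> carrier F"
  by simp

lemma F_diff: "x \<in> carrier F \<Longrightarrow> y \<in> carrier F \<Longrightarrow> x - y \<in> carrier F"
  using F_add[OF _ F_minus, of x y] by simp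

lemma frag_of_F: "a \<in> carrier R \<Longrightarrow> v \<in> carrier V \<Longrightarrow> frag_of (a, v) \<in> carrier F"
  by simp

lemma rels_in_F: "tensor_rels R S V \<subseteq> carrier F"
  unfolding tensor_rels_def
proof (intro subsetI, elim UnE CollectE exE conjE, goal_cases)
  case (1 x a b v)
  then show ?case by (simp only: F_diff frag_of_F R.a_closed)
next
  case (2 x a v w)
  then show ?case by (simp only: F_diff frag_of_F V.a_closed)
next
  case (3 x a s v)
  then have "s \<in> carrier R" using scalars_subset by blast
  with 3 show ?case by (simp only: F_diff frag_of_F R.m_closed scalars_act)
qed

lemma subgroup_N: "subgroup N F"
  unfolding N_def by (rule group.generate_is_subgroup) (simp_all add: rels_in_F del: carrier_free_Abelian_group_iff)

lemma normal_N: "N \<lhd> F"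
  by (rule comm_group.subgroup_imp_normal[OF abelian_free_Abelian_group subgroup_N])

lemma N_subset: "x \<in> N \<Longrightarrow> x \<in> carrier F"
  using subgroup.subset[OF subgroup_N] by blast

lemma N_zero: "0 \<in> N"
  using subgroup.one_closed[OF subgroup_N] by simp

lemma N_add: "x \<in> N \<Longrightarrow> y \<in> N \<Longrightarrow> x + y \<in> N"
  using subgroup.m_closed[OF subgroup_N] by simp

lemma N_minus: "x \<in> N \<Longrightarrow> - x \<in> N"
  using subgroup.m_inv_closed[OF subgroup_N, of x] N_subset[of x] by simp

lemma N_diff: "x \<in> N \<Longrightarrow> y \<in> N \<Longrightarrow> x - y \<in> N"
  using N_add[OF _ N_minus, of x y] by simp

lemma rel_add_left:
  "\<lbrakk>a \<in> carrier R; b \<in> carrier R; v \<in> carrier V\<rbrakk> \<Longrightarrow>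
    frag_of (a \<oplus> b, v) - frag_of (a, v) - frag_of (b, v) \<in> N"
  unfolding N_def by (rule generate.incl, unfold tensor_rels_def, blast)

lemma rel_add_right:
  "\<lbrakk>a \<in> carrier R; v \<in> carrier V; w \<in> carrier V\<rbrakk> \<Longrightarrow>
    frag_of (a, v \<oplus>\<^bsub>V\<^esub> w) - frag_of (a, v) - frag_of (a, w) \<in> N"
  unfolding N_def by (rule generate.incl, unfold tensor_rels_def, blast)

lemma rel_balanced:
  "\<lbrakk>a \<in> carrier R; s \<in> S; v \<in> carrier V\<rbrakk> \<Longrightarrow> frag_of (a \<otimes> s, v) - frag_of (a, s \<odot>\<^bsub>V\<^esub> v) \<in> N"
  unfolding N_def by (rule generate.incl, unfold tensor_rels_def, blast)

lemma coset_eq_iff: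
  assumes "x \<in> carrier F" "y \<in> carrier F"
  shows "N #>\<^bsub>F\<^esub> x = N #>\<^bsub>F\<^esub> y \<longleftrightarrow> x - y \<in> N"
proof
  assume "N #>\<^bsub>F\<^esub> x = N #>\<^bsub>F\<^esub> y"
  moreover have "x \<in> N #>\<^bsub>F\<^esub> x" using N_zero by (force simp: r_coset_def)
  ultimately show "x - y \<in> N" by (auto simp: r_coset_def)
next
  assume "x - y \<in> N"
  then have "x \<in> N #>\<^bsub>F\<^esub> y" by (force simp: r_coset_def)
  then show "N #>\<^bsub>F\<^esub> x = N #>\<^bsub>F\<^esub> y"
    by (rule group.repr_independence[OF group_free_Abelian_group _ assms(2) subgroup_N, symmetric])
qed

lemma carrier_M: "carrier M = (\<lambda>x. N #>\<^bsub>F\<^esub> x) ` carrier F"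
  by (auto simp: induced_module_def Let_def FactGroup_def RCOSETS_def N_def)

lemma M_cases:
  assumes "C \<in> carrier M"
  obtains x where "x \<in> carrier F" "C = N #>\<^bsub>F\<^esub> x"
  using assms unfolding carrier_M by blast

lemma coset_in_M: "x \<in> carrier F \<Longrightarrow> N #>\<^bsub>F\<^esub> x \<in> carrier M"
  unfolding carrier_M by blast

lemma zero_M: "\<zero>\<^bsub>M\<^esub> = N #>\<^bsub>F\<^esub> 0"
  using group.coset_mult_one[OF group_free_Abelian_group, of N] subgroup.subset[OF subgroup_N]
  by (simp add: induced_module_def Let_def FactGroup_def N_def del: carrier_free_Abelian_group_iff)

lemma add_M:
  assumes "x \<in> carrier F" "y \<in> carrier F"
  shows "(N #>\<^bsub>F\<^esub> x) \<oplus>\<^bsub>M\<^esub> (N #>\<^bsub>F\<^esub> y) = N #>\<^bsub>F\<^esub> (x + y)"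
  using normal.rcos_sum[OF normal_N assms]
  by (simp add: induced_module_def Let_def FactGroup_def N_def)

lemma push_simps:
  "push r (frag_of (a, v)) = frag_of (r \<otimes> a, v)"
  "push r (x + y) = push r x + push r y" "push r (x - y) = push r x - push r y"
  "push r (- x) = - push r x" "push r 0 = 0"
  by (simp_all add: push_def frag_extend_add frag_extend_diff frag_extend_minus)

lemma F_induct [consumes 1, case_names zero diff frag_of]:
  assumes "x \<in> carrier F" "P 0"
    and "\<And>x y. \<lbrakk>x \<in> carrier F; y \<in> carrier F; P x; P y\<rbrakk> \<Longrightarrow> P (x - y)"
    and "\<And>a v. \<lbrakk>a \<in> carrier R; v \<in> carrier V\<rbrakk> \<Longrightarrow> P (frag_of (a, v))"
  shows "P x"
  by (rule free_Abelian_group_induct[of x "carrier R \<times> carrier V"]) (use assms in auto)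

lemma push_closed:
  assumes "x \<in> carrier F" "r \<in> carrier R" shows "push r x \<in> carrier F"
  using assms(1)
proof (induction x rule: F_induct)
  case (diff x y)
  then show ?case by (simp only: push_simps F_diff)
qed (simp_all add: push_simps assms)

lemma push_N:
  assumes "x \<in> N" and r: "r \<in> carrier R" shows "push r x \<in> N"
proof -
  have rels: "push r x \<in> N" if "x \<in> tensor_rels R S V" for x
    using that unfolding tensor_rels_def
  proof (elim UnE CollectE exE conjE, goal_cases)
    case (1 a b v)
    then show ?case using rel_add_left[of "r \<otimes> a" "r \<otimes> b" v] r by (simp add: push_simps R.r_distr)
  next
    case (2 a v w)
    then show ?case using rel_add_right[of "r \<otimes> a" v w] r by (simp add: push_simps)
  next
    case (3 a s v)
    then have "s \<in> carrier R" using scalars_subset by blast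
    with 3 show ?case
      using rel_balanced[of "r \<otimes> a" s v] r by (simp add: push_simps R.m_assoc)
  qed
  from \<open>x \<in> N\<close> have "x \<in> generate F (tensor_rels R S V)" by (simp add: N_def)
  then show ?thesis
  proof (induction x rule: generate.induct)
    case one
    then show ?case by (simp add: push_simps N_zero)
  next
    case (incl h)
    then show ?case by (rule rels)
  next
    case (inv h)
    then have "h \<in> carrier F" using rels_in_F by blast
    then show ?case using N_minus[OF rels[OF inv]] by (simp add: push_simps)
  next
    case (eng h1 h2)
    then show ?case using N_add by (simp add: push_simps)
  qed
qed

lemma smult_M:
  assumes x: "x \<in> carrier F" and r: "r \<in> carrier R"
  shows "r \<odot>\<^bsub>M\<^esub> (N #>\<^bsub>F\<^esub> x) = N #>\<^bsub>F\<^esub> push r x"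
proof -
  have "N #>\<^bsub>F\<^esub> push r y = N #>\<^bsub>F\<^esub> push r x" if "y \<in> N #>\<^bsub>F\<^esub> x" for y
  proof -
    from that obtain h where h: "h \<in> N" "y = h + x" by (auto simp: r_coset_def)
    then have "y \<in> carrier F" using F_add[OF N_subset x] by simp
    moreover have "push r y - push r x \<in> N" using push_N[OF h(1) r] by (simp add: h(2) push_simps)
    ultimately show ?thesis by (subst coset_eq_iff) (simp_all only: push_closed x r)
  qed
  moreover have "x \<in> N #>\<^bsub>F\<^esub> x" using N_zero by (force simp: r_coset_def)
  ultimately have "(\<Union>y\<in>N #>\<^bsub>F\<^esub> x. N #>\<^bsub>F\<^esub> push r y) = N #>\<^bsub>F\<^esub> push r x" by blast
  then show ?thesis by (simp add: induced_module_def Let_def N_def push_def)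
qed

lemma abelian_group_M: "abelian_group M"
proof (rule abelian_groupI)
  show "x \<oplus>\<^bsub>M\<^esub> y \<in> carrier M" if "x \<in> carrier M" "y \<in> carrier M" for x y
    using that by (elim M_cases) (simp only: add_M F_add coset_in_M)
  show "\<zero>\<^bsub>M\<^esub> \<in> carrier M" unfolding zero_M by (rule coset_in_M) simp
  show "x \<oplus>\<^bsub>M\<^esub> y \<oplus>\<^bsub>M\<^esub> z = x \<oplus>\<^bsub>M\<^esub> (y \<oplus>\<^bsub>M\<^esub> z)"
    if "x \<in> carrier M" "y \<in> carrier M" "z \<in> carrier M" for x y z
    using that by (elim M_cases) (simp only: add_M F_add add.assoc)
  show "x \<oplus>\<^bsub>M\<^esub> y = y \<oplus>\<^bsub>M\<^esub> x" if "x \<in> carrier M" "y \<in> carrier M" for x y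
    using that by (elim M_cases) (simp only: add_M add.commute)
  have F0: "0 \<in> carrier F" by simp
  show "\<zero>\<^bsub>M\<^esub> \<oplus>\<^bsub>M\<^esub> x = x" if "x \<in> carrier M" for x
    using that by (elim M_cases) (simp only: zero_M add_M F0 add_0)
  show "\<exists>y\<in>carrier M. y \<oplus>\<^bsub>M\<^esub> x = \<zero>\<^bsub>M\<^esub>" if "x \<in> carrier M" for x
  proof -
    from that obtain y where y: "y \<in> carrier F" "x = N #>\<^bsub>F\<^esub> y" by (rule M_cases)
    show ?thesis unfolding y(2)
      by (rule bexI[of _ "N #>\<^bsub>F\<^esub> (- y)"]) (simp_all only: add_M y(1) F_minus zero_M coset_in_M add.left_inverse)
  qed
qed

lemma left_module_M: "left_module R M"
proof (intro left_module.intro left_module_axioms.intro)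
  show "ring R" by (rule R.ring_axioms)
  show "abelian_group M" by (rule abelian_group_M)
  show "a \<odot>\<^bsub>M\<^esub> x \<in> carrier M" if "a \<in> carrier R" "x \<in> carrier M" for a x
    using that by (elim M_cases) (simp only: smult_M push_closed coset_in_M)
  show "a \<odot>\<^bsub>M\<^esub> (x \<oplus>\<^bsub>M\<^esub> y) = a \<odot>\<^bsub>M\<^esub> x \<oplus>\<^bsub>M\<^esub> a \<odot>\<^bsub>M\<^esub> y"
    if "a \<in> carrier R" "x \<in> carrier M" "y \<in> carrier M" for a x y
    using that by (elim M_cases) (simp only: smult_M add_M F_add push_closed push_simps)
  show "(a \<oplus> b) \<odot>\<^bsub>M\<^esub> x = a \<odot>\<^bsub>M\<^esub> x \<oplus>\<^bsub>M\<^esub> b \<odot>\<^bsub>M\<^esub> x"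
    if ab: "a \<in> carrier R" "b \<in> carrier R" and "x \<in> carrier M" for a b x
  proof -
    from \<open>x \<in> carrier M\<close> obtain y where y: "y \<in> carrier F" "x = N #>\<^bsub>F\<^esub> y" by (rule M_cases)
    from y(1) have "push (a \<oplus> b) y - (push a y + push b y) \<in> N"
    proof (induction y rule: F_induct)
      case (diff x y)
      from N_diff[OF diff(3,4)] show ?case by (simp add: push_simps algebra_simps)
    next
      case (frag_of c v)
      then show ?case using rel_add_left[of "a \<otimes> c" "b \<otimes> c" v] ab by (simp add: push_simps R.l_distr algebra_simps)
    qed (simp add: push_simps N_zero)
    then show ?thesis unfolding y(2) using y(1) ab
      by (simp only: smult_M add_M push_closed R.a_closed coset_eq_iff F_add)
  qed
  show "(a \<otimes> b) \<odot>\<^bsub>M\<^esub> x = a \<odot>\<^bsub>M\<^esub> (b \<odot>\<^bsub>M\<^esub> x)"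
    if ab: "a \<in> carrier R" "b \<in> carrier R" and "x \<in> carrier M" for a b x
  proof -
    from \<open>x \<in> carrier M\<close> obtain y where y: "y \<in> carrier F" "x = N #>\<^bsub>F\<^esub> y" by (rule M_cases)
    from y(1) have "push (a \<otimes> b) y = push a (push b y)"
      by (induction y rule: F_induct) (simp_all add: push_simps ab R.m_assoc)
    then show ?thesis unfolding y(2) using y(1) ab
      by (simp only: smult_M push_closed R.m_closed)
  qed
  show "\<one> \<odot>\<^bsub>M\<^esub> x = x" if "x \<in> carrier M" for x
  proof -
    from that obtain y where y: "y \<in> carrier F" "x = N #>\<^bsub>F\<^esub> y" by (rule M_cases)
    from y(1) have "push \<one> y = y"
      by (induction y rule: F_induct) (simp_all add: push_simps)
    then show ?thesis unfolding y(2) using y(1) by (simp only: smult_M R.one_closed)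
  qed
qed

lemma tensor_closed: "a \<in> carrier R \<Longrightarrow> v \<in> carrier V \<Longrightarrow> a \<otimes>\<^sub>t v \<in> carrier M"
  unfolding tensor_def by (intro coset_in_M frag_of_F)

lemma tensor_add_left:
  assumes "a \<in> carrier R" "b \<in> carrier R" "v \<in> carrier V"
  shows "(a \<oplus> b) \<otimes>\<^sub>t v = a \<otimes>\<^sub>t v \<oplus>\<^bsub>M\<^esub> b \<otimes>\<^sub>t v"
proof -
  have "frag_of (a \<oplus> b, v) - frag_of (a, v) - frag_of (b, v) \<in> N"
    by (rule rel_add_left) (use assms in auto)
  then show ?thesis unfolding tensor_def using assms
    by (simp only: add_M frag_of_F R.a_closed coset_eq_iff F_add diff_diff_eq)
qed

lemma tensor_balanced:
  assumes "a \<in> carrier R" "s \<in> S" "v \<in> carrier V"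
  shows "(a \<otimes> s) \<otimes>\<^sub>t v = a \<otimes>\<^sub>t (s \<odot>\<^bsub>V\<^esub> v)"
proof -
  have "frag_of (a \<otimes> s, v) - frag_of (a, s \<odot>\<^bsub>V\<^esub> v) \<in> N"
    by (rule rel_balanced) (use assms in auto)
  then show ?thesis unfolding tensor_def using assms scalars_subset scalars_act
    by (subst coset_eq_iff) (simp_all only: frag_of_F R.m_closed subset_iff)
qed

lemma smult_tensor:
  "r \<in> carrier R \<Longrightarrow> a \<in> carrier R \<Longrightarrow> v \<in> carrier V \<Longrightarrow> r \<odot>\<^bsub>M\<^esub> (a \<otimes>\<^sub>t v) = (r \<otimes> a) \<otimes>\<^sub>t v"
  unfolding tensor_def by (simp only: smult_M frag_of_F push_simps)

text \<open>
  If \<open>V = S v\<close>, then sums of pure tensors collapse: \<open>a \<otimes> s v = a s \<otimes> v\<close>, so the tensor product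
  consists of the elements \<open>a \<otimes> v\<close>.
\<close>

lemma M_cyclic:
  assumes v: "v \<in> carrier V" "carrier V = {s \<odot>\<^bsub>V\<^esub> v | s. s \<in> S}" and x: "x \<in> carrier M"
  shows "\<exists>a\<in>carrier R. x = a \<otimes>\<^sub>t v"
proof -
  from x obtain y where y: "y \<in> carrier F" "x = N #>\<^bsub>F\<^esub> y" by (rule M_cases)
  have "\<exists>a\<in>carrier R. y - frag_of (a, v) \<in> N" using y(1)
  proof (induction y rule: F_induct)
    case zero
    have "frag_of (\<zero> \<oplus> \<zero>, v) - frag_of (\<zero>, v) - frag_of (\<zero>, v) \<in> N"
      using v(1) by (intro rel_add_left) auto
    then show ?case by (intro bexI[of _ \<zero>]) simp_all
  next
    case (diff x y)
    then obtain a b where ab: "a \<in> carrier R" "b \<in> carrier R" "x - frag_of (a, v) \<in> N" "y - frag_of (b, v) \<in> N"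
      by blast
    have "frag_of ((a \<ominus> b) \<oplus> b, v) - frag_of (a \<ominus> b, v) - frag_of (b, v) \<in> N"
      using ab v(1) by (intro rel_add_left) auto
    moreover have "(a \<ominus> b) \<oplus> b = a" using ab by (simp add: R.minus_eq R.a_assoc R.l_neg)
    ultimately have "frag_of (a, v) - frag_of (a \<ominus> b, v) - frag_of (b, v) \<in> N" by simp
    from N_add[OF N_diff[OF ab(3,4)] this] have "x - y - frag_of (a \<ominus> b, v) \<in> N" 
      by (simp add: algebra_simps)
    then show ?case using ab by blast
  next
    case (frag_of a w)
    then obtain s where s: "s \<in> S" "w = s \<odot>\<^bsub>V\<^esub> v" using v(2) by blast
    have "frag_of (a \<otimes> s, v) - frag_of (a, w) \<in> N"
      unfolding s(2) using frag_of(1) s(1) v(1) by (rule rel_balanced)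
    from N_minus[OF this] show ?case
      using frag_of s scalars_subset by (intro bexI[of _ "a \<otimes> s"]) auto
  qed
  then show ?thesis unfolding y(2) tensor_def
    using y(1) v(1) by (metis coset_eq_iff frag_of_F)
qed

text \<open>
  One half of the universal property, in the form in which it detects that a pure tensor is not
  zero: a balanced biadditive map factors through the tensor product.
\<close>

lemma tensor_zeroD:
  fixes h :: "'a \<Rightarrow> 'v \<Rightarrow> 'u::ab_group_add"
  assumes h_left: "\<And>a b v. \<lbrakk>a \<in> carrier R; b \<in> carrier R; v \<in> carrier V\<rbrakk> \<Longrightarrow> h (a \<oplus> b) v = h a v + h b v"
    and h_right: "\<And>a v w. \<lbrakk>a \<in> carrier R; v \<in> carrier V; w \<in> carrier V\<rbrakk> \<Longrightarrow> h a (v \<oplus>\<^bsub>V\<^esub> w) = h a v + h a w"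
    and h_balanced: "\<And>a s v. \<lbrakk>a \<in> carrier R; s \<in> S; v \<in> carrier V\<rbrakk> \<Longrightarrow> h (a \<otimes> s) v = h a (s \<odot>\<^bsub>V\<^esub> v)"
    and av: "a \<in> carrier R" "v \<in> carrier V" and zero: "a \<otimes>\<^sub>t v = \<zero>\<^bsub>M\<^esub>"
  shows "h a v = 0"
proof -
  let ?U = "\<lparr>carrier = UNIV, monoid.mult = (+), one = 0 :: 'u\<rparr>"
  have "comm_group ?U"
    by (rule comm_groupI) (auto simp: add.assoc add.commute intro: exI[of _ "- _"])
  then obtain \<phi> where hom: "\<phi> \<in> hom F ?U"
    and \<phi>: "\<And>p. p \<in> carrier R \<times> carrier V \<Longrightarrow> \<phi> (frag_of p) = (\<lambda>(a, v). h a v) p"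
    by (rule comm_group.free_Abelian_group_universal[where S = "carrier R \<times> carrier V"
          and f = "\<lambda>(a, v). h a v"]) auto
  have \<phi>_add: "\<phi> (x + y) = \<phi> x + \<phi> y" if "x \<in> carrier F" "y \<in> carrier F" for x y
    using hom_mult[OF hom that] by simp
  have \<phi>_0: "\<phi> 0 = 0" using \<phi>_add[of 0 0] by simp
  have \<phi>_minus: "\<phi> (- x) = - \<phi> x" if "x \<in> carrier F" for x
    using \<phi>_add[OF that F_minus[OF that]] \<phi>_0 by (simp add: eq_neg_iff_add_eq_0 add.commute)
  have \<phi>_diff: "\<phi> (x - y) = \<phi> x - \<phi> y" if "x \<in> carrier F" "y \<in> carrier F" for x y
    using \<phi>_add[OF that(1) F_minus[OF that(2)]] \<phi>_minus[OF that(2)] by simp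
  have \<phi>_frag: "\<phi> (frag_of (a, v)) = h a v" if "a \<in> carrier R" "v \<in> carrier V" for a v
    using \<phi> that by simp
  have \<phi>_rels: "\<phi> x = 0" if "x \<in> tensor_rels R S V" for x
    using that unfolding tensor_rels_def
  proof (elim UnE CollectE exE conjE, goal_cases)
    case (1 a b v)
    then show ?case by (simp only: \<phi>_diff \<phi>_frag frag_of_F F_diff R.a_closed h_left) simp
  next
    case (2 a v w)
    then show ?case by (simp only: \<phi>_diff \<phi>_frag frag_of_F F_diff V.a_closed h_right) simp
  next
    case (3 a s v)
    then have "s \<in> carrier R" using scalars_subset by blast
    with 3 show ?case
      by (simp only: \<phi>_diff \<phi>_frag frag_of_F R.m_closed scalars_act h_balanced) simp
  qed
  have "\<phi> x = 0" if "x \<in> N" for x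
    using that unfolding N_def
  proof (induction x rule: generate.induct)
    case (inv h)
    then have "h \<in> carrier F" using rels_in_F by blast
    then show ?case using \<phi>_rels[OF inv] \<phi>_minus by simp
  next
    case (eng h1 h2)
    then show ?case using N_subset[unfolded N_def] by (simp only: mult_free_Abelian_group \<phi>_add) simp
  qed (simp_all add: \<phi>_0 \<phi>_rels)
  moreover have "frag_of (a, v) \<in> N"
    using zero av coset_eq_iff[of "frag_of (a, v)" 0] unfolding tensor_def zero_M by simp
  ultimately have "\<phi> (frag_of (a, v)) = 0" by blast
  then show ?thesis using \<phi>_frag av by simp
qed

lemma tensor_zero_left:
  assumes "v \<in> carrier V" shows "\<zero> \<otimes>\<^sub>t v = \<zero>\<^bsub>M\<^esub>"
proof -
  interpret M: abelian_group M by (rule abelian_group_M)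
  have "\<zero> \<otimes>\<^sub>t v \<oplus>\<^bsub>M\<^esub> \<zero> \<otimes>\<^sub>t v = \<zero> \<otimes>\<^sub>t v"
    using tensor_add_left[of \<zero> \<zero> v] assms by simp
  then show ?thesis using tensor_closed[of \<zero> v] assms
    by (metis M.add.l_cancel_one R.zero_closed)
qed

lemma tensor_eq_iff:
  assumes "a \<in> carrier R" "b \<in> carrier R" "v \<in> carrier V"
  shows "a \<otimes>\<^sub>t v = b \<otimes>\<^sub>t v \<longleftrightarrow> (a \<ominus> b) \<otimes>\<^sub>t v = \<zero>\<^bsub>M\<^esub>"
proof -
  interpret M: abelian_group M by (rule abelian_group_M)
  have "(a \<ominus> b) \<oplus> b = a" using assms by (simp add: R.minus_eq R.a_assoc R.l_neg)
  then have "a \<otimes>\<^sub>t v = (a \<ominus> b) \<otimes>\<^sub>t v \<oplus>\<^bsub>M\<^esub> b \<otimes>\<^sub>t v"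
    using tensor_add_left[of "a \<ominus> b" b v] assms by simp
  then show ?thesis using tensor_closed[of "a \<ominus> b" v] tensor_closed[of b v] assms
    by (metis M.add.r_cancel_one R.minus_closed)
qed

lemma smult_zero:
  assumes "r \<in> carrier R" shows "r \<odot>\<^bsub>M\<^esub> \<zero>\<^bsub>M\<^esub> = \<zero>\<^bsub>M\<^esub>"
  using smult_M[of 0 r] assms by (simp add: zero_M push_simps)

end


section \<open>The affine Hecke algebra as a quotient\<close>

lemma hcls_hom: "hcls q \<in> ring_hom free_ring (hecke q)"
  using ideal.rcos_ring_hom[OF ideal_hecke_ideal, of q] by (simp add: hcls_def[abs_def] hecke_def)

lemma hcls_closed [simp]: "hcls q x \<in> carrier (hecke q)"
  using ring_hom_closed[OF hcls_hom, of x] by (simp add: free_ring_def)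

lemma hcls_mult: "hcls q (x * y) = hcls q x \<otimes>\<^bsub>hecke q\<^esub> hcls q y"
  using ring_hom_mult[OF hcls_hom, of x y] by (simp add: free_ring_def)

lemma hcls_add: "hcls q (x + y) = hcls q x \<oplus>\<^bsub>hecke q\<^esub> hcls q y"
  using ring_hom_add[OF hcls_hom, of x y] by (simp add: free_ring_def)

lemma hcls_1: "hcls q 1 = \<one>\<^bsub>hecke q\<^esub>"
  using ring_hom_one[OF hcls_hom, of q] by (simp add: free_ring_def)

lemma hcls_0: "hcls q 0 = \<zero>\<^bsub>hecke q\<^esub>"
  using ring_hom_zero[OF hcls_hom ring_free_ring ring_hecke, of q] by (simp add: free_ring_def)

lemma hcls_minus: "hcls q (- x) = \<ominus>\<^bsub>hecke q\<^esub> hcls q x"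
proof -
  interpret H: ring "hecke q" by (rule ring_hecke)
  show ?thesis
    using hcls_add[of q "- x" x] by (intro H.minus_equality[symmetric]) (simp_all add: hcls_0)
qed

lemma hcls_diff: "hcls q (x - y) = hcls q x \<ominus>\<^bsub>hecke q\<^esub> hcls q y"
  using hcls_add[of q x "- y"] by (simp add: hcls_minus a_minus_def)

lemma hecke_cases:
  assumes "a \<in> carrier (hecke q)" obtains x where "a = hcls q x"
  using assms by (auto simp: hecke_def FactRing_def A_RCOSETS_def' hcls_def)

lemma hcls_eq_iff: "hcls q x = hcls q y \<longleftrightarrow> x - y \<in> hecke_ideal q"
proof -
  interpret F: ring free_ring by (rule ring_free_ring)
  have "x \<ominus>\<^bsub>free_ring\<^esub> y = x - y"
  proof -
    have "\<ominus>\<^bsub>free_ring\<^esub> y = - y" by (rule F.minus_equality) (simp_all add: free_ring_def)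
    then show ?thesis by (simp add: a_minus_def) (simp add: free_ring_def)
  qed
  then show ?thesis
    using F.quotient_eq_iff_same_a_r_cos[OF ideal_hecke_ideal, of x y q]
    by (simp add: hcls_def free_ring_def)
qed

lemma hecke_sub_subset: "hecke_sub q i \<subseteq> carrier (hecke q)"
  unfolding hecke_sub_def by (rule ring.generate_ring_incl[OF ring_hecke]) auto

lemma fpoly_single: "fpoly (Poly_Mapping.single l z) = fscal z * fgen (GenX l)"
  by (cases "z = 0") (simp_all add: fpoly_def)

lemma hcls_fpoly_in_sub: "hcls q (fpoly f) \<in> hecke_sub q i"
  unfolding hecke_sub_def by (rule generate_ring.incl) auto

lemma hcls_X_in_sub: "hcls q (fgen (GenX l)) \<in> hecke_sub q i"
  using hcls_fpoly_in_sub[of q "xmon l"] by (simp add: fpoly_single)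

text \<open>
  In the quotient the scalar \<open>z\<close> is \<open>z X\<^sup>0\<close>, an element of the group algebra.
\<close>

lemma hcls_fscal_in_sub: "hcls q (fscal z) \<in> hecke_sub q i"
proof -
  have "fgen (GenX 0) - 1 \<in> hecke_ideal q"
    by (rule hecke_rels_in_ideal) (simp add: hecke_rels_def)
  from hecke_ideal_mult_right[OF this, of "fscal z"]
  have "hcls q (fscal z) = hcls q (fpoly (Poly_Mapping.single 0 z))"
    by (subst eq_commute) (simp add: hcls_eq_iff fpoly_single fscal_central left_diff_distrib)
  then show ?thesis using hcls_fpoly_in_sub by metis
qed

section \<open>The module induced from a line\<close>

text \<open>
  The hypotheses on the line are those of the module \<open>M\<close>, with \<open>e = \<epsilon> q\<close>: the weight
  \<open>t = s\<^sub>1 s\<^sub>2 t'\<close> is \<open>a \<alpha>\<^sub>1 + b \<alpha>\<^sub>2 \<mapsto> e\<^bsup>2 b - a\<^esup>\<close>. The condition \<open>e\<^sup>2 + e + 1 \<noteq> 0\<close> is the form that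
  \<open>t'(X\<^bsup>\<alpha>\<^sub>2\<^esup>) \<noteq> q\<^sup>-\<^sup>2\<close>, that is \<open>e\<^sup>3 \<noteq> 1\<close>, takes when \<open>e \<noteq> 1\<close>.
\<close>

locale g2_line =
  fixes q \<epsilon> e :: complex and V :: "(free_alg set, 'v) module" and v :: 'v
  assumes e: "e \<noteq> 0" "e\<^sup>2 \<noteq> 1" "e\<^sup>2 + e + 1 \<noteq> 0"
    and \<epsilon>: "\<epsilon>\<^sup>2 = 1" and q: "q = \<epsilon> * e"
    and line: "line_module q N2 q (\<lambda>l. e powi (2 * snd l - fst l)) V v"
begin

abbreviation "H \<equiv> hecke q"
abbreviation "H2 \<equiv> hecke_sub q N2"
abbreviation "cl \<equiv> hcls q"
abbreviation "t \<equiv> \<lambda>l::lattice. e powi (2 * snd l - fst l)"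
abbreviation "act \<equiv> model.act \<epsilon> e"
abbreviation v0 :: vec6 where "v0 \<equiv> (1, 0, 0, 0, 0, 0)"

lemma V_module: "left_module (H\<lparr>carrier := H2\<rparr>) V"
  and v_in: "v \<in> carrier V" and v_nonzero: "v \<noteq> \<zero>\<^bsub>V\<^esub>"
  and V_line: "carrier V = {cl (fscal z) \<odot>\<^bsub>V\<^esub> v | z. True}"
  and T2_v: "cl (fgen (GenT N2)) \<odot>\<^bsub>V\<^esub> v = cl (fscal q) \<odot>\<^bsub>V\<^esub> v"
  and X_v: "cl (fgen (GenX l)) \<odot>\<^bsub>V\<^esub> v = cl (fscal (t l)) \<odot>\<^bsub>V\<^esub> v"
  using line unfolding line_module_def by blast+

sublocale V: left_module "H\<lparr>carrier := H2\<rparr>" V by (rule V_module)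

sublocale tensor_product H H2 V
proof (intro tensor_product.intro tensor_product_axioms.intro)
  show "s \<odot>\<^bsub>V\<^esub> v \<in> carrier V" if "s \<in> H2" "v \<in> carrier V" for s v
    using V.lsmult_closed that by simp
qed (rule ring_hecke V.abelian_group_axioms hecke_sub_subset)+

abbreviation pure_tensor (infix \<open>\<otimes>\<^sub>t\<close> 71) where "a \<otimes>\<^sub>t w \<equiv> tensor a w"

lemma act_ideal: "x \<in> hecke_ideal q \<Longrightarrow> act x u = 0"
  by (rule model.act_hecke_ideal[of q]) (use model_hecke_rels[OF e(1,2) \<epsilon>] q in auto)

text \<open>
  A class acts through any representative, because the ideal acts by zero.
\<close>

definition hact :: "free_alg set \<Rightarrow> vec6 \<Rightarrow> vec6" where
  "hact a = act (SOME x. a = cl x)"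

lemma hact_hcls: "hact (cl x) u = act x u"
proof -
  have "cl x = cl (SOME y. cl x = cl y)" by (rule someI[of _ x]) simp
  then have "act (x - (SOME y. cl x = cl y)) u = 0" by (intro act_ideal) (simp only: hcls_eq_iff)
  then show ?thesis by (simp add: hact_def model.act_diff)
qed

lemma hact_add: "a \<in> carrier H \<Longrightarrow> b \<in> carrier H \<Longrightarrow> hact (a \<oplus>\<^bsub>H\<^esub> b) u = hact a u + hact b u"
  by (elim hecke_cases) (simp add: hcls_add[symmetric] hact_hcls model.act_add)

lemma hact_mult: "a \<in> carrier H \<Longrightarrow> b \<in> carrier H \<Longrightarrow> hact (a \<otimes>\<^bsub>H\<^esub> b) u = hact a (hact b u)"
  by (elim hecke_cases) (simp add: hcls_mult[symmetric] hact_hcls model.act_mult)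

lemma hact_csc: "a \<in> carrier H \<Longrightarrow> hact a (csc z u) = csc z (hact a u)"
  by (elim hecke_cases) (simp add: hact_hcls model.act_right_linear)

lemma V_add: "a \<in> H2 \<Longrightarrow> b \<in> H2 \<Longrightarrow> w \<in> carrier V \<Longrightarrow>
    (a \<oplus>\<^bsub>H\<^esub> b) \<odot>\<^bsub>V\<^esub> w = a \<odot>\<^bsub>V\<^esub> w \<oplus>\<^bsub>V\<^esub> b \<odot>\<^bsub>V\<^esub> w"
  using V.lsmult_l_distr[of a b w] by simp

lemma V_mult: "a \<in> H2 \<Longrightarrow> b \<in> H2 \<Longrightarrow> w \<in> carrier V \<Longrightarrow>
    (a \<otimes>\<^bsub>H\<^esub> b) \<odot>\<^bsub>V\<^esub> w = a \<odot>\<^bsub>V\<^esub> (b \<odot>\<^bsub>V\<^esub> w)"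
  using V.lsmult_assoc[of a b w] by simp

lemma V_one: "w \<in> carrier V \<Longrightarrow> cl 1 \<odot>\<^bsub>V\<^esub> w = w"
  using V.lsmult_one[of w] by (simp add: hcls_1)

lemma V_zero: "w \<in> carrier V \<Longrightarrow> cl 0 \<odot>\<^bsub>V\<^esub> w = \<zero>\<^bsub>V\<^esub>"
  using V_add[of "cl 0" "cl 0" w] hcls_fscal_in_sub[of q 0 N2] scalars_act[of "cl 0" w]
  by (simp add: hcls_add[symmetric])

abbreviation sc :: "complex \<Rightarrow> 'v" where "sc z \<equiv> cl (fscal z) \<odot>\<^bsub>V\<^esub> v"

lemma sc_closed: "sc z \<in> carrier V"
  by (rule scalars_act[OF hcls_fscal_in_sub v_in])

lemma sc_add: "sc (y + z) = sc y \<oplus>\<^bsub>V\<^esub> sc z"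
  by (simp add: fscal_add hcls_add V_add hcls_fscal_in_sub v_in)

lemma sc_mult: "sc (y * z) = cl (fscal y) \<odot>\<^bsub>V\<^esub> sc z"
  by (simp add: fscal_mult hcls_mult V_mult hcls_fscal_in_sub v_in)

lemma sc_eq_iff: "sc y = sc z \<longleftrightarrow> y = z"
proof
  assume eq: "sc y = sc z"
  show "y = z"
  proof (rule ccontr)
    assume "y \<noteq> z"
    have sc0: "sc 0 = \<zero>\<^bsub>V\<^esub>" using V_zero[OF v_in] by simp
    have "sc (y - z) \<oplus>\<^bsub>V\<^esub> sc z = sc z" using eq sc_add[of "y - z" z] by simp
    then have "sc (y - z) = \<zero>\<^bsub>V\<^esub>" using sc_closed by (metis V.add.r_cancel_one)
    then have "sc (inverse (y - z) * (y - z)) = sc (inverse (y - z) * 0)"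
      unfolding sc_mult by (simp only: sc0)
    then have "sc 1 = \<zero>\<^bsub>V\<^esub>" using \<open>y \<noteq> z\<close> sc0 by simp
    then show False using V_one[OF v_in] v_nonzero by simp
  qed
qed simp

definition coord :: "'v \<Rightarrow> complex" where
  "coord w = (THE z. w = sc z)"

lemma coord_sc: "coord (sc z) = z"
  unfolding coord_def by (rule the_equality) (simp_all add: sc_eq_iff)

lemma line_cases:
  assumes "w \<in> carrier V" obtains z where "w = sc z"
  using assms V_line by auto

lemma T_model_v0: "T_model e N2 v0 = csc e v0"
  by simp

lemma X_model_v0: "X_model e l v0 = csc (t l) v0"
  by (cases l) (simp add: Let_def)

text \<open>
  The lines spanned by \<open>v\<close> and by the first basis vector of the model are isomorphic over the
  parabolic subalgebra; this gives the map from the induced module to the model.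
\<close>

lemma common_eigenvalue:
  assumes "s \<in> H2" shows "\<exists>\<zeta>. s \<odot>\<^bsub>V\<^esub> v = sc \<zeta> \<and> hact s v0 = csc \<zeta> v0"
  using assms unfolding hecke_sub_def
proof (induction s rule: generate_ring.induct)
  case one
  show ?case using V_one[OF v_in] 
    by (intro exI[of _ 1]) (simp add: hcls_1[symmetric] hact_hcls del: csc_simp)
next
  case (incl h)
  then consider "h = cl (fgen (GenT N2))" | f where "h = cl (fpoly f)" by auto
  then show ?case
  proof cases
    case 1
    then show ?thesis
      by (intro exI[of _ q]) (simp only: T2_v hact_hcls model.act_fgen gen_model.simps T_model_v0
          vec6.scale_scale flip: q)
  next
    case (2 f)
    have "\<exists>\<zeta>. cl (\<Sum>l\<in>A. fscal (g l) * fgen (GenX l)) \<in> H2 \<and>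
        cl (\<Sum>l\<in>A. fscal (g l) * fgen (GenX l)) \<odot>\<^bsub>V\<^esub> v = sc \<zeta> \<and>
        act (\<Sum>l\<in>A. fscal (g l) * fgen (GenX l)) v0 = csc \<zeta> v0" for A g
    proof (induction A rule: infinite_finite_induct)
      case (insert l A)
      then obtain \<zeta> where \<zeta>: "cl (\<Sum>l\<in>A. fscal (g l) * fgen (GenX l)) \<in> H2"
        "cl (\<Sum>l\<in>A. fscal (g l) * fgen (GenX l)) \<odot>\<^bsub>V\<^esub> v = sc \<zeta>"
        "act (\<Sum>l\<in>A. fscal (g l) * fgen (GenX l)) v0 = csc \<zeta> v0" by blast
      have 1: "cl (fscal (g l) * fgen (GenX l)) \<in> H2"
        unfolding hcls_mult using hcls_fscal_in_sub hcls_X_in_sub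
        unfolding hecke_sub_def by (rule generate_ring.eng_mult)
      have 2: "cl (fscal (g l) * fgen (GenX l)) \<odot>\<^bsub>V\<^esub> v = sc (g l * t l)"
        by (simp only: hcls_mult V_mult hcls_fscal_in_sub hcls_X_in_sub v_in X_v sc_mult)
      have 3: "act (fscal (g l) * fgen (GenX l)) v0 = csc (g l * t l) v0"
        by (simp only: model.act_mult model.act_fgen model.act_fscal gen_model.simps X_model_v0
            vec6.scale_scale)
      have "cl (fscal (g l) * fgen (GenX l) + (\<Sum>l\<in>A. fscal (g l) * fgen (GenX l))) \<in> H2"
        using 1 \<zeta>(1) unfolding hcls_add hecke_sub_def by (rule generate_ring.eng_add)
      then show ?case unfolding sum.insert[OF insert(1,2)]
        by (intro exI[of _ "g l * t l + \<zeta>"] conjI)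
          (simp_all only: hcls_add V_add 1 2 3 \<zeta> v_in sc_add model.act_add vec6.scale_left_distrib)
    qed (use V_zero[OF v_in] hcls_fscal_in_sub[of q 0 N2] in \<open>auto simp: zero_prod_def intro!: exI[of _ 0]\<close>)
    from this[of "\<lambda>l. Poly_Mapping.lookup f l" "Poly_Mapping.keys f"] show ?thesis
      unfolding 2 hact_hcls fpoly_def by blast
  qed
next
  case (a_inv h)
  then obtain \<zeta> where \<zeta>: "h \<odot>\<^bsub>V\<^esub> v = sc \<zeta>" "hact h v0 = csc \<zeta> v0" by blast
  have h: "h \<in> H2" using a_inv(1) by (simp add: hecke_sub_def)
  then obtain x where x: "h = cl x" using hecke_sub_subset by (blast elim: hecke_cases)
  have "\<ominus>\<^bsub>H\<^esub> h = cl (fscal (- 1)) \<otimes>\<^bsub>H\<^esub> h"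
  proof -
    have "fscal (- 1) = - 1" by (metis fscal_def single_one single_uminus)
    then show ?thesis by (simp add: x hcls_mult[symmetric] hcls_minus[symmetric])
  qed
  moreover have "(cl (fscal (- 1)) \<otimes>\<^bsub>H\<^esub> h) \<odot>\<^bsub>V\<^esub> v = sc (- 1 * \<zeta>)"
    by (simp only: V_mult hcls_fscal_in_sub h v_in \<zeta> sc_mult)
  moreover have "hact (cl (fscal (- 1)) \<otimes>\<^bsub>H\<^esub> h) v0 = csc (- 1 * \<zeta>) v0"
    using h hecke_sub_subset
    by (simp only: hact_mult hcls_closed subset_iff \<zeta> hact_hcls model.act_fscal vec6.scale_scale)
  ultimately show ?case by metis
next
  case (eng_add a b)
  then obtain y z where yz: "a \<odot>\<^bsub>V\<^esub> v = sc y" "hact a v0 = csc y v0" "b \<odot>\<^bsub>V\<^esub> v = sc z" "hact b v0 = csc z v0"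
    by blast
  have ab: "a \<in> H2" "b \<in> H2" using eng_add(1,2) by (simp_all add: hecke_sub_def)
  then show ?case using scalars_subset
    by (intro exI[of _ "y + z"])
      (simp only: V_add v_in yz sc_add hact_add subset_iff vec6.scale_left_distrib)
next
  case (eng_mult a b)
  then obtain y z where yz: "a \<odot>\<^bsub>V\<^esub> v = sc y" "hact a v0 = csc y v0" "b \<odot>\<^bsub>V\<^esub> v = sc z" "hact b v0 = csc z v0"
    by blast
  have ab: "a \<in> H2" "b \<in> H2" using eng_mult(1,2) by (simp_all add: hecke_sub_def)
  obtain x where x: "a = cl x" using ab hecke_sub_subset by (blast elim: hecke_cases)
  have "a \<odot>\<^bsub>V\<^esub> sc z = cl (fscal z) \<odot>\<^bsub>V\<^esub> (a \<odot>\<^bsub>V\<^esub> v)"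
    using ab(1) v_in hcls_fscal_in_sub unfolding x
    by (simp only: V_mult[symmetric] hcls_mult[symmetric] fscal_central)
  then have "a \<odot>\<^bsub>V\<^esub> sc z = sc (z * y)" by (simp only: yz sc_mult)
  then show ?case using ab scalars_subset
    by (intro exI[of _ "z * y"])
      (simp only: V_mult v_in yz hact_mult hact_csc subset_iff vec6.scale_scale)
qed

lemma tensor_zero_imp_act_zero:
  assumes zero: "cl x \<otimes>\<^sub>t v = \<zero>\<^bsub>M\<^esub>" shows "act x v0 = 0"
proof -
  (* The map a (x) z v -> z a v0. *)
  let ?h = "\<lambda>a w. csc (coord w) (hact a v0)"
  have "?h (cl x) v = 0"
  proof (rule tensor_zeroD[where h = ?h, OF _ _ _ hcls_closed v_in zero])
    show "?h (a \<oplus>\<^bsub>H\<^esub> b) w = ?h a w + ?h b w" if "a \<in> carrier H" "b \<in> carrier H" for a b w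
      using that by (simp only: hact_add vec6.scale_right_distrib)
    show "?h a (w \<oplus>\<^bsub>V\<^esub> w') = ?h a w + ?h a w'" if "w \<in> carrier V" "w' \<in> carrier V" for a w w'
      using that by (elim line_cases) (simp only: sc_add[symmetric] coord_sc vec6.scale_left_distrib)
    show "?h (a \<otimes>\<^bsub>H\<^esub> s) w = ?h a (s \<odot>\<^bsub>V\<^esub> w)" if a: "a \<in> carrier H" and s: "s \<in> H2" and "w \<in> carrier V" for a s w
    proof -
      obtain \<zeta> where \<zeta>: "s \<odot>\<^bsub>V\<^esub> v = sc \<zeta>" "hact s v0 = csc \<zeta> v0" using common_eigenvalue[OF s] by blast
      obtain z where z: "w = sc z" using \<open>w \<in> carrier V\<close> by (rule line_cases)
      have sH: "s \<in> carrier H" using s scalars_subset by blast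
      then obtain y where y: "s = cl y" by (rule hecke_cases)
      have "s \<odot>\<^bsub>V\<^esub> sc z = cl (fscal z) \<odot>\<^bsub>V\<^esub> (s \<odot>\<^bsub>V\<^esub> v)"
        using s v_in hcls_fscal_in_sub unfolding y
        by (simp only: V_mult[symmetric] hcls_mult[symmetric] fscal_central)
      then have "s \<odot>\<^bsub>V\<^esub> w = sc (z * \<zeta>)" by (simp only: \<zeta> z sc_mult)
      then show ?thesis
        using a sH by (simp only: z coord_sc hact_mult \<zeta> hact_csc vec6.scale_scale)
    qed
  qed
  moreover have "v = sc 1" using V_one[OF v_in] by simp
  then have "coord v = 1" using coord_sc[of 1] by simp
  ultimately show ?thesis by (simp add: hact_hcls del: csc_simp)
qed

text \<open>
  The induced module and the model are isomorphic by \<open>x \<otimes> v \<mapsto> x v0\<close>. If \<open>x v0 = 0\<close>, write \<open>x\<close>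
  modulo the annihilator of \<open>1 \<otimes> v\<close> as a combination of the six coset words; applied to \<open>v0\<close>
  these are independent, so the combination is zero.
\<close>

lemma tensor_zero_iff: "cl x \<otimes>\<^sub>t v = \<zero>\<^bsub>M\<^esub> \<longleftrightarrow> act x v0 = 0"
proof
  interpret M: abelian_group M by (rule abelian_group_M)
  assume x: "act x v0 = 0"
  define L where "L = {a. cl a \<otimes>\<^sub>t v = \<zero>\<^bsub>M\<^esub>}"
  have L_diff: "a - b \<in> L" if "cl a \<otimes>\<^sub>t v = cl b \<otimes>\<^sub>t v" for a b
    using that tensor_eq_iff[of "cl a" "cl b" v] v_in by (simp add: L_def hcls_diff)
  have one_tensor: "s \<otimes>\<^sub>t v = cl 1 \<otimes>\<^sub>t (s \<odot>\<^bsub>V\<^esub> v)" if "s \<in> H2" for s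
    using tensor_balanced[of "cl 1" s v] that v_in scalars_subset by (auto simp: hcls_1 subset_iff)
  have "\<exists>z. x - (\<Sum>j<6. fscal (z j) * T_coset j) \<in> L"
  proof (rule T_coset_spanning[where q = q and c = q and t = t])
    show "a + b \<in> L" if "a \<in> L" "b \<in> L" for a b
      using that v_in by (simp add: L_def hcls_add tensor_add_left)
    show "a * b \<in> L" if "b \<in> L" for a b
      using that v_in smult_tensor[of "cl a" "cl b" v] by (simp add: L_def hcls_mult smult_zero)
    show "hecke_ideal q \<subseteq> L"
    proof
      fix a assume "a \<in> hecke_ideal q"
      then have "cl a = cl 0" by (simp add: hcls_eq_iff)
      then show "a \<in> L" using tensor_zero_left[OF v_in] by (simp add: L_def hcls_0)
    qed
    have "cl (fgen (GenT N2)) \<in> H2" unfolding hecke_sub_def by (rule generate_ring.incl) simp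
    then show "fgen (GenT N2) - fscal q \<in> L"
      by (intro L_diff) (simp only: one_tensor T2_v hcls_fscal_in_sub)
    show "fgen (GenX l) - fscal (t l) \<in> L" for l
      by (intro L_diff) (simp only: one_tensor X_v hcls_fscal_in_sub hcls_X_in_sub)
  qed
  then obtain z where z: "x - (\<Sum>j<6. fscal (z j) * T_coset j) \<in> L" by blast
  then have "act (x - (\<Sum>j<6. fscal (z j) * T_coset j)) v0 = 0"
    by (intro tensor_zero_imp_act_zero) (simp add: L_def)
  then have "act (\<Sum>j<6. fscal (z j) * T_coset j) v0 = 0" by (simp only: model.act_diff x) simp
  moreover have "\<epsilon> \<noteq> 0" using \<epsilon> by auto
  ultimately have "z j = 0" if "j < 6" for j using T_coset_independent[OF e(1,3)] that by blast
  then have "(\<Sum>j<6. fscal (z j) * T_coset j) = 0" by simp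
  then show "cl x \<otimes>\<^sub>t v = \<zero>\<^bsub>M\<^esub>" using z by (simp add: L_def)
qed (rule tensor_zero_imp_act_zero)

text \<open>
  The image of a nonzero submodule in the irreducible model contains \<open>v0\<close>, and \<open>v0\<close> corresponds to
  \<open>1 \<otimes> v\<close>.
\<close>

lemma generator_in_submodule:
  assumes K: "submodule K H M" and "K \<noteq> {\<zero>\<^bsub>M\<^esub>}"
  shows "cl 1 \<otimes>\<^sub>t v \<in> K"
proof -
  interpret K: submodule K H M by (rule K)
  have cyclic: "\<exists>a. x = cl a \<otimes>\<^sub>t v" if x: "x \<in> carrier M" for x
  proof -
    have "carrier V = {s \<odot>\<^bsub>V\<^esub> v | s. s \<in> H2}"
      using V_line hcls_fscal_in_sub scalars_act v_in by blast
    then obtain a where "a \<in> carrier H" "x = a \<otimes>\<^sub>t v" using M_cyclic[OF v_in _ x] by blast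
    then show ?thesis by (metis hecke_cases)
  qed
  define J where "J = {a. cl a \<otimes>\<^sub>t v \<in> K}"
  have J_add: "a + b \<in> J" if "a \<in> J" "b \<in> J" for a b
    using that K.m_closed v_in by (simp add: J_def hcls_add tensor_add_left)
  have J_mult: "a * b \<in> J" if "b \<in> J" for a b
    using that K.smult_closed[of "cl a" "cl b \<otimes>\<^sub>t v"] v_in by (simp add: J_def hcls_mult smult_tensor)
  have "\<zero>\<^bsub>M\<^esub> \<in> K" using K.one_closed by simp
  then obtain x where "x \<in> K" "x \<noteq> \<zero>\<^bsub>M\<^esub>" using assms(2) by blast
  moreover then obtain a where "x = cl a \<otimes>\<^sub>t v" using cyclic K.subset by auto
  ultimately have a: "a \<in> J" "act a v0 \<noteq> 0" by (auto simp: J_def tensor_zero_iff)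
  define U where "U = (\<lambda>a. act a v0) ` J"
  have "v0 \<in> U"
  proof (rule model_irreducible[OF e])
    show "u + u' \<in> U" if "u \<in> U" "u' \<in> U" for u u'
      using that J_add unfolding U_def by (auto simp: model.act_add[symmetric])
    have U_act: "act a u \<in> U" if "u \<in> U" for a u
      using that J_mult unfolding U_def by (auto simp: model.act_mult[symmetric])
    show csc: "csc z u \<in> U" if "u \<in> U" for z u
      using U_act[OF that, of "fscal z"] by simp
    show "X_model e l u \<in> U" if "u \<in> U" for l u
      using U_act[OF that, of "fgen (GenX l)"] by simp
    show "T_model e i u \<in> U" if "u \<in> U" for i u
      using csc[OF U_act[OF that, of "fgen (GenT i)"], of \<epsilon>] \<epsilon> by (simp add: power2_eq_square)
    show "act a v0 \<in> U" using a by (simp add: U_def)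
  qed (rule a(2))
  then obtain b where "b \<in> J" "act b v0 = v0" by (auto simp: U_def)
  then have "act (b - 1) v0 = 0" by (simp only: model.act_diff model.act_1) simp
  then have "cl (b - 1) \<otimes>\<^sub>t v = \<zero>\<^bsub>M\<^esub>" by (simp add: tensor_zero_iff)
  then have "cl b \<otimes>\<^sub>t v = cl 1 \<otimes>\<^sub>t v"
    using tensor_eq_iff[of "cl b" "cl 1" v] v_in by (simp add: hcls_diff)
  then show ?thesis using \<open>b \<in> J\<close> by (simp add: J_def)
qed

theorem induced_irreducible: "irreducible_module H M"
  unfolding irreducible_module_def
proof (intro conjI allI impI)
  show "left_module H M" by (rule left_module_M)
  have "cl 1 \<otimes>\<^sub>t v \<noteq> \<zero>\<^bsub>M\<^esub>" by (simp add: tensor_zero_iff zero_prod_def)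
  then show "carrier M \<noteq> {\<zero>\<^bsub>M\<^esub>}" using tensor_closed[of "cl 1" v] v_in by auto
  fix K assume K: "submodule K H M"
  interpret K: submodule K H M by (rule K)
  have "carrier M \<subseteq> K" if "K \<noteq> {\<zero>\<^bsub>M\<^esub>}"
  proof
    fix x assume "x \<in> carrier M"
    have "carrier V = {s \<odot>\<^bsub>V\<^esub> v | s. s \<in> H2}"
      using V_line hcls_fscal_in_sub scalars_act v_in by blast
    then obtain a where a: "a \<in> carrier H" "x = a \<otimes>\<^sub>t v"
      using M_cyclic[OF v_in _ \<open>x \<in> carrier M\<close>] by blast
    have "a \<odot>\<^bsub>M\<^esub> (cl 1 \<otimes>\<^sub>t v) \<in> K"
      using K.smult_closed[OF a(1) generator_in_submodule[OF K that]] .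
    then show "x \<in> K" using a v_in by (simp add: smult_tensor hcls_1)
  qed
  then show "K = {\<zero>\<^bsub>M\<^esub>} \<or> K = carrier M" using K.subset by auto
qed

end

section \<open>The two weights and the symmetry between them\<close>

lemma longest_eq: "longest l = - l"
  by (cases l) (simp add: longest_def srefl_def scale_def pairing_def)

lemma weyl_act_longest: "weyl_act longest t l = t (- l)"
proof -
  have "inv_into UNIV longest = longest"
    by (rule inv_equality) (simp_all add: longest_eq)
  then show ?thesis by (simp add: weyl_act_def longest_eq)
qed

lemma weyl_act_s1_s2_weight:
  "weyl_act (srefl N1 \<circ> srefl N2) (weight_of 1 e) l = e powi (2 * snd l - fst l)"
  by (cases l) (simp add: weyl_act_comp[OF bij_srefl bij_srefl] srefl_def scale_def pairing_def
      weight_of_def algebra_simps)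

text \<open>
  The parameter \<open>q\<close> enters the relations only through \<open>q - q\<^sup>-\<^sup>1\<close>.
\<close>

lemma hecke_neg_inverse:
  assumes "q \<noteq> 0"
  shows "hecke (- inverse q) = hecke q" "hcls (- inverse q) = hcls q"
    "hecke_sub (- inverse q) = hecke_sub q"
proof -
  have "- inverse q - inverse (- inverse q) = q - inverse q" using assms by simp
  then have "hecke_rels (- inverse q) = hecke_rels q" unfolding hecke_rels_def by metis
  then have I: "hecke_ideal (- inverse q) = hecke_ideal q" by (simp add: hecke_ideal_def)
  then show 1: "hecke (- inverse q) = hecke q" by (simp add: hecke_def)
  show 2: "hcls (- inverse q) = hcls q" by (simp add: hcls_def[abs_def] I)
  show "hecke_sub (- inverse q) = hecke_sub q" by (simp add: hecke_sub_def[abs_def] 1 2)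
qed

theorem proposition27:
  fixes q \<epsilon> :: complex
    and t t' :: "lattice \<Rightarrow> complex"
    and V :: "(free_alg set, 'v) module" and v :: 'v
    and W :: "(free_alg set, 'w) module" and w :: 'w
  assumes "q \<noteq> 0" and "q\<^sup>2 \<noteq> 1" and "\<epsilon> \<in> {1, -1}"
    and "t' = weight_of 1 (\<epsilon> * q)"
    and "t = weyl_act (srefl N1 \<circ> srefl N2) t'"
    and "line_module q N2 q t V v"
    and "line_module q N2 (- inverse q) (weyl_act longest t) W w"
    and "t' (simple_root N2) \<noteq> inverse (q\<^sup>2)"
  shows "irreducible_module (hecke q) (induced_module (hecke q) (hecke_sub q N2) V)
      \<and> irreducible_module (hecke q) (induced_module (hecke q) (hecke_sub q N2) W)"
proof -
  define e where "e = \<epsilon> * q"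
  have \<epsilon>: "\<epsilon>\<^sup>2 = 1" "\<epsilon> * \<epsilon> = 1" using \<open>\<epsilon> \<in> {1, -1}\<close> by auto
  have q: "q = \<epsilon> * e" using \<epsilon>(2) by (simp add: e_def mult.assoc[symmetric])
  have e: "e \<noteq> 0" "e\<^sup>2 \<noteq> 1" "e\<^sup>2 = q\<^sup>2"
    using assms(1,2) \<epsilon> by (auto simp: e_def power_mult_distrib)
  have "e \<noteq> inverse (e\<^sup>2)" using assms(8)
    unfolding assms(4) e(3) weight_of_simple_root by (simp add: e_def)
  then have "e ^ 3 \<noteq> 1"
    using e(1) by (auto simp: field_simps power2_eq_square power3_eq_cube)
  moreover have "e ^ 3 - 1 = (e - 1) * (e\<^sup>2 + e + 1)"
    by (simp add: algebra_simps power2_eq_square power3_eq_cube)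
  ultimately have e3: "e\<^sup>2 + e + 1 \<noteq> 0" by auto
  have t: "t = (\<lambda>l. e powi (2 * snd l - fst l))"
    by (rule ext) (simp only: assms(4,5) weyl_act_s1_s2_weight e_def)
  interpret V: g2_line q \<epsilon> e V v
    by unfold_locales (use e e3 \<epsilon> q assms(6) t in simp_all)
  (* For - 1/q the eigenvalue - 1/q of T_2 plays the part of q, and since w_0 = -1 the weight w_0 t
     is the inverse of t. *)
  interpret W: g2_line "- inverse q" "- \<epsilon>" "inverse e" W w
  proof
    show "inverse e \<noteq> 0" "(inverse e)\<^sup>2 \<noteq> 1" "(- \<epsilon>)\<^sup>2 = 1"
      using e \<epsilon> by (auto simp: power_inverse)
    have "(inverse e)\<^sup>2 + inverse e + 1 = (e\<^sup>2 + e + 1) / e\<^sup>2"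
      using e(1) by (simp add: field_simps power2_eq_square)
    then show "(inverse e)\<^sup>2 + inverse e + 1 \<noteq> 0" using e3 e(1) by simp
    have "inverse \<epsilon> = \<epsilon>" using \<epsilon>(2) by (metis inverse_unique)
    then show "- inverse q = - \<epsilon> * inverse e" by (simp add: q)
    have W_weight: "weyl_act longest t = (\<lambda>l. inverse e powi (2 * snd l - fst l))"
    proof
      fix l
      show "weyl_act longest t l = inverse e powi (2 * snd l - fst l)"
        using power_int_minus[of e "2 * snd l - fst l"]
        by (simp add: weyl_act_longest t power_int_inverse)
    qed
    show "line_module (- inverse q) N2 (- inverse q) (\<lambda>l. inverse e powi (2 * snd l - fst l)) W w"
      using assms(7) unfolding line_module_def hecke_neg_inverse[OF \<open>q \<noteq> 0\<close>] W_weight .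
  qed
  show ?thesis
    using V.induced_irreducible W.induced_irreducible
    by (simp add: hecke_neg_inverse[OF \<open>q \<noteq> 0\<close>])
qed

end
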